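(* Let $D_1,\dots,D_m\subseteq\mathbb{R}^n$ be nonempty, closed and convex, let $C=\mathbb{R}^n$, and let $\psi\in\Theta$ be strictly concave on $\mathbb{R}_+$. Let $\Psi(x):=\sum_{i=1}^m\psi(d_{D_i}^2(x))$ and $$\mathfrak{M}(x,\xi,u):=\sum_{i=1}^m\left[\rho^*(u_i)-u_i\|x-\xi_i\|^2+\delta_{D_i}(\xi_i)\right],\quad x\in\mathbb{R}^n,\ \xi=(\xi_1,\dots,\xi_m)\in\mathbb{R}^{mn},\ u\in\mathbb{R}^m.$$ If $\Psi$ is a KL function with exponent $\theta\in[\frac12,1)$, then $\mathfrak{M}$ is a KL function with exponent $\theta$.
   Context: $\Theta$ denotes the set of level-bounded (i.e., $\{s\ge0:\psi(s)\le\gamma\}$ is bounded for every $\gamma\in\mathbb{R}$) continuous concave functions $\psi:\mathbb{R}_+\to\mathbb{R}_+$ such that: (1) $\psi$ is continuously differentiable on $(0,\infty)$ with positive derivative and $\psi(0)=0$; (2) $\lim_{s\downarrow0}\psi'(s)$ exists (as a real number) and is positive, and the right derivative $\psi'_+$ is Lipschitz continuous on $\mathbb{R}_+=[0,\infty)$. The convex function $\rho:\mathbb{R}\to\mathbb{R}$ is defined by $\rho(s)=-\psi(s)$ if $s\ge0$ and $\rho(s)=s^2-ls$ if $s<0$, where $l:=\psi_+'(0)>0$; $\rho^*$ is its convex conjugate. $d_D(x)=\mathrm{dist}(x,D)$ is the Euclidean distance to $D$ and $\delta_D$ is the indicator function ($0$ on $D$, $+\infty$ elsewhere). For a proper closed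 $f$ and $\bar x\in\mathrm{dom} f$, $\widehat\partial f(\bar x)=\{v:\liminf_{x\to\bar x,x\ne\bar x}\frac{f(x)-f(\bar x)-\langle v,x-\bar x\rangle}{\|x-\bar x\|}\ge0\}$ and $\partial f(\bar x)=\{v:\exists\,x^t\to\bar x,\ f(x^t)\to f(\bar x),\ v^t\in\widehat\partial f(x^t),\ v^t\to v\}$ (empty outside $\mathrm{dom} f$); $\mathrm{dom}\,\partial f=\{x:\partial f(x)\ne\emptyset\}$. A proper closed function $f$ satisfies the KL property with exponent $\theta\in[0,1)$ at $\hat x\in\mathrm{dom}\,\partial f$ if there exist a neighborhood $\mathcal N$ of $\hat x$, $\nu\in(0,\infty]$ and $c>0$ such that, with $\phi(s)=cs^{1-\theta}$, $\phi'(f(x)-f(\hat x))\,\mathrm{dist}(0,\partial f(x))\ge1$ whenever $x\in\mathcal N$ and $f(\hat x)<f(x)<f(\hat x)+\nu$. $f$ is a KL function with exponent $\theta$ if this holds at every point of $\mathrm{dom}\,\partial f$. *)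

theory Defs
  imports "HOL-Analysis.Analysis"
begin

section \<open>Extended-real-valued functions and subdifferentials\<close>

definition dom :: "('a \<Rightarrow> ereal) \<Rightarrow> 'a set" where
  "dom f = {x. f x < \<infinity>}"

definition proper :: "('a \<Rightarrow> ereal) \<Rightarrow> bool" where
  "proper f \<longleftrightarrow> dom f \<noteq> {} \<and> (\<forall>x. f x \<noteq> - \<infinity>)"

text \<open>Closedness of a function means lower semicontinuity.\<close>

definition closed_fun :: "('a::topological_space \<Rightarrow> ereal) \<Rightarrow> bool" where
  "closed_fun f \<longleftrightarrow> (\<forall>x. f x \<le> Liminf (at x) f)"

definition frechet_subdiff :: "('a::euclidean_space \<Rightarrow> ereal) \<Rightarrow> 'a \<Rightarrow> 'a set" where
  "frechet_subdiff f x =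
     {v. x \<in> dom f \<and>
         Liminf (at x) (\<lambda>y. (f y - f x - ereal (v \<bullet> (y - x))) / ereal (norm (y - x))) \<ge> 0}"

definition limiting_subdiff :: "('a::euclidean_space \<Rightarrow> ereal) \<Rightarrow> 'a \<Rightarrow> 'a set" where
  "limiting_subdiff f x =
     {v. x \<in> dom f \<and>
         (\<exists>X V. X \<longlonglongrightarrow> x \<and> (\<lambda>t. f (X t)) \<longlonglongrightarrow> f x \<and>
                (\<forall>t. V t \<in> frechet_subdiff f (X t)) \<and> V \<longlonglongrightarrow> v)}"

definition dom_subdiff :: "('a::euclidean_space \<Rightarrow> ereal) \<Rightarrow> 'a set" where
  "dom_subdiff f = {x. limiting_subdiff f x \<noteq> {}}"

text \<open>
  The distance is extended-real-valued so that the distance to the empty set is infinite;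
  \<open>infdist\<close> and \<open>setdist\<close> would return 0 there, which is wrong for the KL inequality at points
  with empty subdifferential.
\<close>

definition edist_set :: "'a::real_normed_vector \<Rightarrow> 'a set \<Rightarrow> ereal" where
  "edist_set x A = (INF v\<in>A. ereal (dist x v))"

section \<open>The Kurdyka--Lojasiewicz property\<close>

text \<open>
  In the inequality below both \<open>f x\<close> and \<open>f z\<close> are finite and \<open>f z < f x\<close>, so \<open>real_of_ereal\<close> is
  applied to a positive real and \<open>deriv\<close> is evaluated where the power function is differentiable.
\<close>

definition KL_at :: "('a::euclidean_space \<Rightarrow> ereal) \<Rightarrow> real \<Rightarrow> 'a \<Rightarrow> bool" where
  "KL_at f \<theta> z \<longleftrightarrow>
     (\<exists>N \<nu> c. open N \<and> z \<in> N \<and> (\<nu>::ereal) > 0 \<and> (c::real) > 0 \<and>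
        (\<forall>x\<in>N. f z < f x \<and> f x < f z + \<nu> \<longrightarrow>
           ereal (deriv (\<lambda>s. c * s powr (1 - \<theta>)) (real_of_ereal (f x - f z)))
             * edist_set 0 (limiting_subdiff f x) \<ge> 1))"

definition KL_function :: "('a::euclidean_space \<Rightarrow> ereal) \<Rightarrow> real \<Rightarrow> bool" where
  "KL_function f \<theta> \<longleftrightarrow>
     proper f \<and> closed_fun f \<and> 0 \<le> \<theta> \<and> \<theta> < 1 \<and> (\<forall>z\<in>dom_subdiff f. KL_at f \<theta> z)"

section \<open>The class of functions and the potential\<close>

definition right_deriv :: "(real \<Rightarrow> real) \<Rightarrow> real \<Rightarrow> real" where
  "right_deriv f s = Lim (at_right s) (\<lambda>t. (f t - f s) / (t - s))"

text \<open>
  Functions on the half-line are represented by total functions on \<^typ>\<open>real\<close>; their values at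
  negative arguments are unconstrained and never used.
\<close>

definition Theta :: "(real \<Rightarrow> real) set" where
  "Theta = {\<psi>.
     (\<forall>s\<ge>0. \<psi> s \<ge> 0) \<and>
     (\<forall>\<gamma>. bounded {s. s \<ge> 0 \<and> \<psi> s \<le> \<gamma>}) \<and>
     continuous_on {0..} \<psi> \<and> concave_on {0..} \<psi> \<and>
     (\<forall>s>0. \<psi> differentiable (at s) \<and> deriv \<psi> s > 0) \<and>
     continuous_on {0<..} (deriv \<psi>) \<and> \<psi> 0 = 0 \<and>
     (\<exists>L>0. (deriv \<psi> \<longlongrightarrow> L) (at_right 0)) \<and>
     (\<exists>K. K-lipschitz_on {0..} (right_deriv \<psi>))}"

definition strictly_concave_on :: "'a::real_vector set \<Rightarrow> ('a \<Rightarrow> real) \<Rightarrow> bool" where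
  "strictly_concave_on S f \<longleftrightarrow> convex S \<and>
     (\<forall>x\<in>S. \<forall>y\<in>S. \<forall>t. x \<noteq> y \<and> 0 < t \<and> t < 1 \<longrightarrow>
        f ((1 - t) *\<^sub>R x + t *\<^sub>R y) > (1 - t) * f x + t * f y)"

definition rho :: "(real \<Rightarrow> real) \<Rightarrow> real \<Rightarrow> real" where
  "rho \<psi> s = (if s \<ge> 0 then - \<psi> s else s\<^sup>2 - right_deriv \<psi> 0 * s)"

definition convex_conjugate :: "('a::real_inner \<Rightarrow> real) \<Rightarrow> 'a \<Rightarrow> ereal" where
  "convex_conjugate f t = (SUP s. ereal (t \<bullet> s - f s))"

definition indicator_fun :: "'a set \<Rightarrow> 'a \<Rightarrow> ereal" where
  "indicator_fun D x = (if x \<in> D then 0 else \<infinity>)"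

definition Psi :: "(real \<Rightarrow> real) \<Rightarrow> ('m::finite \<Rightarrow> (real^'n) set) \<Rightarrow> real^'n \<Rightarrow> ereal" where
  "Psi \<psi> D x = ereal (\<Sum>i\<in>UNIV. \<psi> ((infdist x (D i))\<^sup>2))"

text \<open>
  No summand is \<open>- \<infinity>\<close>: the conjugate is bounded below by \<open>- rho \<psi> 0\<close>.  The product type
  carries the Euclidean inner product of the concatenated vector.
\<close>

definition frakM ::
  "(real \<Rightarrow> real) \<Rightarrow> ('m::finite \<Rightarrow> (real^'n) set) \<Rightarrow> (real^'n) \<times> (real^'n^'m) \<times> (real^'m) \<Rightarrow> ereal"
where
  "frakM \<psi> D = (\<lambda>(x, \<xi>, u). \<Sum>i\<in>UNIV.
     convex_conjugate (rho \<psi>) (u $ i) - ereal (u $ i * (norm (x - \<xi> $ i))\<^sup>2)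
       + indicator_fun (D i) (\<xi> $ i))"

end

theory Submission
  imports Defs
begin

text \<open>
  Let \<open>v = (v\<^sub>x, v\<^sub>\<xi>, v\<^sub>u)\<close> be a Frechet subgradient of \<open>frakM\<close> at \<open>(x, \<xi>, u)\<close>.  Put
  \<open>r\<^sub>i = \<parallel>x - \<xi>\<^sub>i\<parallel>\<^sup>2\<close> and \<open>s\<^sub>i = r\<^sub>i + (v\<^sub>u)\<^sub>i\<close>.  Then \<open>s\<^sub>i\<close> is a subgradient of the conjugate of
  \<open>\<rho>\<close> at \<open>u\<^sub>i\<close>, so \<open>u\<^sub>i = \<rho>'(s\<^sub>i)\<close>; moreover \<open>\<xi>\<^sub>i\<close> is the projection onto \<open>D\<^sub>i\<close> of a point at
  distance \<open>O(\<parallel>v\<parallel>)\<close> from \<open>x\<close>, and \<open>v\<^sub>x = - 2 \<Sum> u\<^sub>i (x - \<xi>\<^sub>i)\<close>.  Since \<open>\<rho>'\<close> is Lipschitz, this yields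
  \<open>frakM (x, \<xi>, u) - \<Psi> x = O(\<parallel>v\<parallel>\<^sup>2)\<close> and \<open>\<nabla>\<Psi> x = v\<^sub>x + O(\<parallel>v\<parallel>)\<close>.  As \<open>\<Psi> \<le> frakM\<close> at the
  reference point, the KL inequality of \<open>\<Psi>\<close> gives that of \<open>frakM\<close> for Frechet subgradients; the
  quadratic error is absorbed because \<open>\<theta> \<ge> 1/2\<close>.  Limiting subgradients follow by continuity.
\<close>

section \<open>Frechet subgradients and the KL inequality\<close>

text \<open>The filter is \<open>nhds z\<close> rather than \<open>at z\<close>, so that the bound
  can be composed with a curve tending to \<open>z\<close> that may stay at
  \<open>z\<close>.\<close>

lemma frechet_subdiff_lower_bound:
  assumes "v \<in> frechet_subdiff f z" "f z = ereal F" "\<epsilon> > 0"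
  shows "eventually (\<lambda>y. f y \<ge> ereal (F + v \<bullet> (y - z) - \<epsilon> * norm (y - z))) (nhds z)"
proof -
  have "Liminf (at z) (\<lambda>y. (f y - f z - ereal (v \<bullet> (y - z))) / ereal (norm (y - z))) \<ge> 0"
    using assms(1) by (auto simp: frechet_subdiff_def)
  then have "eventually (\<lambda>y. ereal (- \<epsilon>) < (f y - f z - ereal (v \<bullet> (y - z))) / ereal (norm (y - z))) (at z)"
    using assms(3) by (auto simp: le_Liminf_iff)
  then have "eventually (\<lambda>y. f y \<ge> ereal (F + v \<bullet> (y - z) - \<epsilon> * norm (y - z))) (at z)"
    using eventually_neq_at_within[of z z UNIV]
  proof eventually_elim
    case (elim y)
    then have n: "norm (y - z) > 0" by simp
    show ?case
    proof (cases "f y")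
      case (real r)
      with elim n assms(2) show ?thesis
        by (simp add: field_simps)
    next
      case MInf
      with elim n assms(2) show ?thesis by simp
    qed simp
  qed
  then show ?thesis
    using assms(2) by (simp add: eventually_nhds_conv_at)
qed

text \<open>Compare the lower bound with \<open>up\<close> along the segment, divide by
  \<open>t\<close>, let \<open>t\<close> tend to 0 and then \<epsilon>. Only an upper bound on
  \<open>f\<close> along one segment is needed, so feasible directions suffice where
  \<open>f\<close> takes infinite values.\<close>

lemma frechet_subdiff_direction:
  assumes v: "v \<in> frechet_subdiff f z" and F: "f z = ereal F"
    and up: "\<And>t. 0 < t \<Longrightarrow> t \<le> 1 \<Longrightarrow> f (z + t *\<^sub>R d) \<le> ereal (F + t * A + t\<^sup>2 * B)"
  shows "v \<bullet> d \<le> A"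
proof -
  have "v \<bullet> d \<le> A + \<epsilon> * norm d" if e: "\<epsilon> > 0" for \<epsilon> :: real
  proof -
    have lim: "((\<lambda>t::real. z + t *\<^sub>R d) \<longlongrightarrow> z) (at_right 0)"
      by (auto intro!: tendsto_eq_intros)
    have "eventually (\<lambda>t. f (z + t *\<^sub>R d) \<ge>
        ereal (F + v \<bullet> (z + t *\<^sub>R d - z) - \<epsilon> * norm (z + t *\<^sub>R d - z))) (at_right (0::real))"
      using frechet_subdiff_lower_bound[OF v F e] lim by (rule eventually_compose_filterlim)
    moreover have "eventually (\<lambda>t::real. t \<in> {0<..<1}) (at_right 0)"
      by (rule eventually_at_right_real) simp
    ultimately have "eventually (\<lambda>t. v \<bullet> d \<le> A + \<epsilon> * norm d + t * B) (at_right (0::real))"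
    proof eventually_elim
      case (elim t)
      then have "ereal (F + t * (v \<bullet> d) - \<epsilon> * (t * norm d)) \<le> ereal (F + t * A + t\<^sup>2 * B)"
        using up[of t] by (auto simp: abs_of_pos simp del: ereal_less_eq intro: order_trans)
      then have "t * (v \<bullet> d) \<le> t * (A + \<epsilon> * norm d + t * B)"
        by (simp add: algebra_simps power2_eq_square)
      with elim show ?case by simp
    qed
    moreover have "((\<lambda>t. A + \<epsilon> * norm d + t * B) \<longlongrightarrow> A + \<epsilon> * norm d) (at_right 0)"
      by (auto intro!: tendsto_eq_intros)
    ultimately show ?thesis
      by (intro tendsto_lowerbound[where F="at_right (0::real)"]) auto
  qed
  \<comment> \<open>For \<open>d \<noteq> 0\<close> take \<open>e / norm d\<close> as the \<epsilon>
    above.\<close>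
  then have *: "v \<bullet> d \<le> A + e" if "e > 0" for e
    using that
    by (cases "d = 0") (force, metis nonzero_divide_eq_eq norm_eq_zero zero_less_norm_iff zero_less_divide_iff)
  show ?thesis by (rule field_le_epsilon) (rule *)
qed

text \<open>The error \<open>C * (norm (y - x))\<^sup>2\<close> is of smaller order than
  \<open>norm (y - x)\<close>. This yields subgradients without proving differentiability.\<close>

lemma quadratic_minorant_imp_frechet:
  assumes "eventually (\<lambda>y. g y \<ge> g x + v \<bullet> (y - x) - C * (norm (y - x))\<^sup>2) (nhds x)"
  shows "v \<in> frechet_subdiff (\<lambda>y. ereal (g y)) x"
proof -
  have ev: "eventually (\<lambda>y. e < (ereal (g y) - ereal (g x) - ereal (v \<bullet> (y - x))) / ereal (norm (y - x))) (at x)"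
    if "e < 0" for e :: ereal
  proof -
    \<comment> \<open>\<open>e\<close> may be minus infinity, so a negative real above it is
      chosen.\<close>
    obtain e' where e': "e \<le> ereal e'" "e' < 0"
    proof (cases e)
      case (real r)
      with \<open>e < 0\<close> show ?thesis by (intro that[of r]) auto
    qed (use \<open>e < 0\<close> in \<open>auto intro: that[of "-1"]\<close>)
    have "((\<lambda>y. - C * norm (y - x)) \<longlongrightarrow> 0) (at x)"
      by (auto intro!: tendsto_eq_intros)
    then have "eventually (\<lambda>y. - C * norm (y - x) > e') (at x)"
      using e'(2) by (rule order_tendstoD)
    moreover have "eventually (\<lambda>y. g y \<ge> g x + v \<bullet> (y - x) - C * (norm (y - x))\<^sup>2) (at x)"
      using assms by (simp add: eventually_nhds_conv_at)
    ultimately show ?thesis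
      using eventually_neq_at_within[of x x UNIV]
    proof eventually_elim
      case (elim y)
      then have n: "norm (y - x) > 0" by simp
      have "e' * norm (y - x) < - C * norm (y - x) * norm (y - x)"
        using elim(1) n by (intro mult_strict_right_mono) auto
      also have "\<dots> \<le> g y - g x - v \<bullet> (y - x)"
        using elim(2) by (simp add: power2_eq_square algebra_simps)
      finally have "e' < (g y - g x - v \<bullet> (y - x)) / norm (y - x)"
        using n by (simp add: field_simps)
      with e'(1) n show ?case by (auto intro: le_less_trans)
    qed
  qed
  then show ?thesis
    by (auto simp: frechet_subdiff_def dom_def le_Liminf_iff)
qed

lemma frechet_subset_limiting: "frechet_subdiff f x \<subseteq> limiting_subdiff f x"
proof
  fix v assume v: "v \<in> frechet_subdiff f x"
  then have "x \<in> dom f" by (simp add: frechet_subdiff_def)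
  then show "v \<in> limiting_subdiff f x"
    unfolding limiting_subdiff_def using v
    by (intro CollectI conjI exI[of _ "\<lambda>_. x"] exI[of _ "\<lambda>_. v"]) auto
qed

lemma deriv_scaled_powr:
  fixes r :: real
  assumes "r > 0"
  shows "deriv (\<lambda>s. c * s powr (1 - \<theta>)) r = c * (1 - \<theta>) * r powr (- \<theta>)"
  using DERIV_cmult[OF has_real_derivative_powr[OF assms, of "1 - \<theta>"], of c]
  by (intro DERIV_imp_deriv) (simp add: mult.assoc)

text \<open>The bound \<open>bd\<close> is the KL inequality with the derivative of the power
  written out; \<open>c = C / (1 - \<theta>)\<close> cancels the factor \<open>1 - \<theta>\<close>,
  and \<open>r < 1\<close> corresponds to \<nu> = 1. It passes to limiting subgradients because
  these are limits of Frechet subgradients along which the values of \<open>f\<close> also converge,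
  and both sides are continuous.\<close>

lemma KL_atI_frechet:
  fixes f :: "'a::euclidean_space \<Rightarrow> ereal"
  assumes \<theta>: "0 \<le> \<theta>" "\<theta> < 1" and N: "open N" "z \<in> N" and fz: "f z = ereal a" and "C > 0"
    and bd: "\<And>x r v. x \<in> N \<Longrightarrow> f x = ereal (a + r) \<Longrightarrow> 0 < r \<Longrightarrow> r < 1 \<Longrightarrow>
      v \<in> frechet_subdiff f x \<Longrightarrow> r powr \<theta> \<le> C * norm v"
  shows "KL_at f \<theta> z"
proof -
  have lim: "r powr \<theta> \<le> C * norm v"
    if x: "x \<in> N" "f x = ereal (a + r)" "0 < r" "r < 1" and v: "v \<in> limiting_subdiff f x" for x r v
  proof -
    from v obtain X V where X: "X \<longlonglongrightarrow> x" "(\<lambda>t. f (X t)) \<longlonglongrightarrow> f x"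
      "\<And>t. V t \<in> frechet_subdiff f (X t)" "V \<longlonglongrightarrow> v"
      by (auto simp: limiting_subdiff_def)
    have lr: "(\<lambda>t. real_of_ereal (f (X t)) - a) \<longlonglongrightarrow> r"
      using tendsto_diff[OF lim_real_of_ereal[of "\<lambda>t. f (X t)" "a + r"] tendsto_const[of a]] X(2) x(2)
      by simp
    have "eventually (\<lambda>t. X t \<in> N) sequentially"
      using X(1) N x(1) by (auto dest: topological_tendstoD)
    moreover have "eventually (\<lambda>t. f (X t) > ereal a) sequentially"
      using X(2) x by (intro order_tendstoD) auto
    moreover have "eventually (\<lambda>t. f (X t) < ereal (a + 1)) sequentially"
      using X(2) x by (intro order_tendstoD) auto
    ultimately have "eventually (\<lambda>t. (real_of_ereal (f (X t)) - a) powr \<theta> \<le> C * norm (V t)) sequentially"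
    proof eventually_elim
      case (elim t)
      then obtain b where b: "f (X t) = ereal b" by (cases "f (X t)") auto
      show ?case
        using bd[of "X t" "b - a" "V t"] elim X(3) b by simp
    qed
    moreover have "(\<lambda>t. (real_of_ereal (f (X t)) - a) powr \<theta>) \<longlonglongrightarrow> r powr \<theta>"
      using x(3) by (intro tendsto_powr lr tendsto_const) auto
    moreover have "(\<lambda>t. C * norm (V t)) \<longlonglongrightarrow> C * norm v"
      by (intro tendsto_intros X)
    ultimately show ?thesis
      by (intro tendsto_le[OF sequentially_bot]) auto
  qed
  show ?thesis
    unfolding KL_at_def
  proof (intro exI[of _ N] exI[of _ "1::ereal"] exI[of _ "C / (1 - \<theta>)"] conjI ballI impI)
    fix x assume x: "x \<in> N" and fx: "f z < f x \<and> f x < f z + 1"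
    define r where "r = real_of_ereal (f x - f z)"
    have r: "f x = ereal (a + r)" "0 < r" "r < 1"
      using fx fz by (cases "f x"; auto simp: r_def one_ereal_def)+
    \<comment> \<open>An empty subdifferential is included: the infimum is then infinite.\<close>
    have "ereal (r powr \<theta> / C) \<le> edist_set 0 (limiting_subdiff f x)"
      unfolding edist_set_def
      using lim[OF x r] \<open>C > 0\<close> by (auto intro!: INF_greatest simp: field_simps)
    moreover have "deriv (\<lambda>s. C / (1 - \<theta>) * s powr (1 - \<theta>)) r = C * r powr (- \<theta>)"
      using \<theta> r by (subst deriv_scaled_powr) auto
    ultimately have "ereal (C * r powr (- \<theta>)) * ereal (r powr \<theta> / C)
      \<le> ereal (deriv (\<lambda>s. C / (1 - \<theta>) * s powr (1 - \<theta>)) r) * edist_set 0 (limiting_subdiff f x)"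
      using \<open>C > 0\<close> by (simp only:) (rule ereal_mult_left_mono, auto)
    moreover have "ereal (C * r powr (- \<theta>)) * ereal (r powr \<theta> / C) = 1"
      using \<open>C > 0\<close> r by (simp add: powr_minus field_simps one_ereal_def)
    ultimately show "ereal (deriv (\<lambda>s. C / (1 - \<theta>) * s powr (1 - \<theta>)) (real_of_ereal (f x - f z)))
        * edist_set 0 (limiting_subdiff f x) \<ge> 1"
      by (simp only: r_def)
  qed (use N \<theta> \<open>C > 0\<close> in auto)
qed

text \<open>A Frechet subgradient \<open>G x\<close> is also a limiting one, so its norm bounds the
  distance in the KL inequality from above. Continuity of \<open>g\<close> lets the upper
  restriction on \<open>g x\<close> be absorbed into the neighbourhood.\<close>

lemma KL_atE_frechet:
  fixes g :: "'a::euclidean_space \<Rightarrow> real"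
  assumes "KL_at (\<lambda>y. ereal (g y)) \<theta> z" "\<theta> < 1" and cont: "continuous_on UNIV g"
    and G: "\<And>y. G y \<in> frechet_subdiff (\<lambda>y. ereal (g y)) y"
  obtains N C where "open N" "z \<in> N" "C > 0"
    "\<And>x. x \<in> N \<Longrightarrow> g z < g x \<Longrightarrow> (g x - g z) powr \<theta> \<le> C * norm (G x)"
proof -
  obtain N \<nu> c where N: "open N" "z \<in> N" "(\<nu>::ereal) > 0" "c > 0" and
    kl: "\<And>x. x \<in> N \<Longrightarrow> g z < g x \<Longrightarrow> ereal (g x) < ereal (g z) + \<nu> \<Longrightarrow>
           ereal (deriv (\<lambda>s. c * s powr (1 - \<theta>)) (g x - g z))
             * edist_set 0 (limiting_subdiff (\<lambda>y. ereal (g y)) x) \<ge> 1"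
    using assms(1) unfolding KL_at_def by auto
  \<comment> \<open>\<nu> may be infinite; a real bound is needed to cut out an open set.\<close>
  obtain \<nu>' where \<nu>': "0 < ereal \<nu>'" "ereal \<nu>' < \<nu>"
    using ereal_dense2[OF N(3)] by blast
  define N' where "N' = N \<inter> {y. g y < g z + \<nu>'}"
  have "open N'" unfolding N'_def
    using cont N(1) by (intro open_Int open_Collect_less) auto
  moreover have "z \<in> N'" using N \<nu>' by (simp add: N'_def)
  moreover have "(g x - g z) powr \<theta> \<le> c * (1 - \<theta>) * norm (G x)" if x: "x \<in> N'" "g z < g x" for x
  proof -
    have "ereal (g x) < ereal (g z + \<nu>')" using x by (simp add: N'_def)
    also have "\<dots> \<le> ereal (g z) + \<nu>" using \<nu>' by (cases \<nu>) auto
    finally have "ereal (deriv (\<lambda>s. c * s powr (1 - \<theta>)) (g x - g z))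
             * edist_set 0 (limiting_subdiff (\<lambda>y. ereal (g y)) x) \<ge> 1"
      using kl[of x] x by (simp add: N'_def)
    moreover have "edist_set 0 (limiting_subdiff (\<lambda>y. ereal (g y)) x) \<le> ereal (dist 0 (G x))"
      unfolding edist_set_def using G[of x] frechet_subset_limiting by (intro INF_lower) blast
    moreover have d: "deriv (\<lambda>s. c * s powr (1 - \<theta>)) (g x - g z) = c * (1 - \<theta>) * (g x - g z) powr (- \<theta>)"
      using x by (intro deriv_scaled_powr) simp
    moreover have "0 \<le> c * (1 - \<theta>) * (g x - g z) powr (- \<theta>)"
      using N \<open>\<theta> < 1\<close> by simp
    ultimately have "1 \<le> ereal (c * (1 - \<theta>) * (g x - g z) powr (- \<theta>)) * ereal (dist 0 (G x))"
      by (elim order_trans) (auto intro!: ereal_mult_left_mono simp del: times_ereal.simps)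
    then have "1 \<le> c * (1 - \<theta>) * (g x - g z) powr (- \<theta>) * norm (G x)"
      by (simp add: one_ereal_def)
    with x show ?thesis by (simp add: powr_minus field_simps)
  qed
  moreover have "c * (1 - \<theta>) > 0" using N \<open>\<theta> < 1\<close> by simp
  ultimately show ?thesis using that by blast
qed

section \<open>The function \<open>\<rho>\<close> and its conjugate\<close>

text \<open>The derivative of \<open>rho \<psi>\<close>. The two branches meet continuously at 0,
  where both give \<open>- right_deriv \<psi> 0\<close>.\<close>

definition rho_slope :: "(real \<Rightarrow> real) \<Rightarrow> real \<Rightarrow> real" where
  "rho_slope \<psi> s = (if s \<ge> 0 then - right_deriv \<psi> s else 2 * s - right_deriv \<psi> 0)"

lemma Theta_right_deriv_eq_deriv:
  assumes "\<psi> \<in> Theta" "s > 0"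
  shows "(\<psi> has_real_derivative right_deriv \<psi> s) (at s)" "right_deriv \<psi> s > 0"
proof -
  have d: "(\<psi> has_real_derivative deriv \<psi> s) (at s)" and pos: "deriv \<psi> s > 0"
    using assms by (auto simp: Theta_def DERIV_deriv_iff_real_differentiable)
  have "((\<lambda>t. (\<psi> t - \<psi> s) / (t - s)) \<longlongrightarrow> deriv \<psi> s) (at_right s)"
    using d unfolding has_field_derivative_iff by (rule tendsto_within_subset) simp
  then have "right_deriv \<psi> s = deriv \<psi> s"
    unfolding right_deriv_def by (intro tendsto_Lim) auto
  with d pos show "(\<psi> has_real_derivative right_deriv \<psi> s) (at s)" "right_deriv \<psi> s > 0" by auto
qed

text \<open>For \<open>s > 0\<close> this is the supporting line of a concave function at an
  interior point. The endpoint \<open>s = 0\<close> follows by letting \<open>s\<close> decrease to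
  0, since \<psi> and its Lipschitz right derivative are continuous on the half-line.\<close>

lemma Theta_tangent:
  assumes \<psi>: "\<psi> \<in> Theta" and s: "s \<ge> 0" and y: "y \<ge> 0"
  shows "\<psi> y \<le> \<psi> s + right_deriv \<psi> s * (y - s)"
proof -
  have conc: "convex_on {0..} (\<lambda>t. - \<psi> t)" and cont: "continuous_on {0..} \<psi>"
    using \<psi> by (auto simp: Theta_def concave_on_def)
  obtain K where "K-lipschitz_on {0..} (right_deriv \<psi>)"
    using \<psi> unfolding Theta_def by blast
  then have contd: "continuous_on {0..} (right_deriv \<psi>)"
    by (rule lipschitz_on_continuous_on)
  have pos: "\<psi> y \<le> \<psi> s + right_deriv \<psi> s * (y - s)" if s: "s > 0" for s
  proof -
    have "((\<lambda>t. - \<psi> t) has_real_derivative - right_deriv \<psi> s) (at s within {0..})"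
      using Theta_right_deriv_eq_deriv(1)[OF \<psi> s]
      by (intro DERIV_minus) (auto intro: DERIV_subset)
    then show ?thesis
      using convex_on_imp_above_tangent[OF conc, of s y "- right_deriv \<psi> s"] s y
      by (auto simp: interior_real_atLeast algebra_simps)
  qed
  show ?thesis
  proof (cases "s = 0")
    case True
    have "(\<psi> \<longlongrightarrow> \<psi> 0) (at_right 0)" "(right_deriv \<psi> \<longlongrightarrow> right_deriv \<psi> 0) (at_right 0)"
      using cont contd by (auto simp: continuous_on_def intro: tendsto_within_subset)
    then have "((\<lambda>s. \<psi> s + right_deriv \<psi> s * (y - s)) \<longlongrightarrow> \<psi> 0 + right_deriv \<psi> 0 * (y - 0)) (at_right 0)"
      by (intro tendsto_intros)
    moreover have "eventually (\<lambda>s. \<psi> y \<le> \<psi> s + right_deriv \<psi> s * (y - s)) (at_right 0)"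
      using eventually_at_right_less[of "0::real"] by eventually_elim (rule pos)
    ultimately show ?thesis
      using True by (auto intro: tendsto_lowerbound)
  qed (use pos s in auto)
qed

lemma Theta_0 [simp]: "\<psi> \<in> Theta \<Longrightarrow> \<psi> 0 = 0"
  by (simp add: Theta_def)

text \<open>Add the tangent inequalities at \<open>s\<close> and at 0.\<close>

lemma Theta_right_deriv_le:
  assumes "\<psi> \<in> Theta" "s \<ge> 0"
  shows "right_deriv \<psi> s \<le> right_deriv \<psi> 0"
proof (cases "s = 0")
  case False
  with assms have "s > 0" by simp
  moreover have "s * right_deriv \<psi> s \<le> s * right_deriv \<psi> 0"
    using Theta_tangent[of \<psi> s 0] Theta_tangent[of \<psi> 0 s] assms by (simp add: algebra_simps)
  ultimately show ?thesis by simp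
qed simp

lemma Theta_right_deriv_pos:
  assumes "\<psi> \<in> Theta" "s \<ge> 0"
  shows "right_deriv \<psi> s > 0"
  using Theta_right_deriv_eq_deriv(2)[OF assms(1), of s] Theta_right_deriv_eq_deriv(2)[OF assms(1), of 1]
    Theta_right_deriv_le[OF assms(1), of 1] assms(2)
  by (cases "s = 0") auto

lemma Theta_mono:
  assumes "\<psi> \<in> Theta" "0 \<le> q" "q \<le> r"
  shows "\<psi> q \<le> \<psi> r"
proof -
  have "right_deriv \<psi> r * (q - r) \<le> 0"
    using assms Theta_right_deriv_pos[of \<psi> r] by (intro mult_nonneg_nonpos) auto
  with Theta_tangent[of \<psi> r q] assms show ?thesis by simp
qed

text \<open>Equal signs reduce to concavity of \<psi> or to a perfect square. Across 0, compare with
  the line of slope \<open>right_deriv \<psi> 0\<close>, which dominates \<psi> and is at least as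
  steep as every later tangent.\<close>

lemma rho_tangent:
  assumes \<psi>: "\<psi> \<in> Theta"
  shows "rho \<psi> y \<ge> rho \<psi> s + rho_slope \<psi> s * (y - s)"
proof -
  let ?l = "right_deriv \<psi> 0"
  consider "s \<ge> 0" "y \<ge> 0" | "s \<ge> 0" "y < 0" | "s < 0" "y \<ge> 0" | "s < 0" "y < 0" by linarith
  then show ?thesis
  proof cases
    case 1
    then show ?thesis using Theta_tangent[OF \<psi>, of s y] by (simp add: rho_def rho_slope_def)
  next
    case 2
    have "right_deriv \<psi> s * s \<le> \<psi> s"
      using Theta_tangent[OF \<psi>, of s 0] 2 \<psi> by (simp add: algebra_simps)
    moreover have "?l * y \<le> right_deriv \<psi> s * y"
      using 2 Theta_right_deriv_le[OF \<psi>, of s] by (intro mult_right_mono_neg) auto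
    ultimately have "y\<^sup>2 - ?l * y \<ge> - \<psi> s + - right_deriv \<psi> s * (y - s)"
      using zero_le_power2[of y] by (simp only: algebra_simps; linarith)
    then show ?thesis using 2 by (simp add: rho_def rho_slope_def)
  next
    case 3
    have "\<psi> y \<le> ?l * y"
      using Theta_tangent[OF \<psi>, of 0 y] 3 \<psi> by simp
    moreover have "s * y \<le> 0" using 3 by (simp add: mult_le_0_iff)
    ultimately have "- \<psi> y \<ge> s\<^sup>2 - ?l * s + (2 * s - ?l) * (y - s)"
      using zero_le_power2[of s] by (simp only: algebra_simps power2_eq_square; linarith)
    then show ?thesis using 3 by (simp add: rho_def rho_slope_def)
  next
    case 4
    have "0 \<le> (y - s)\<^sup>2" by simp
    with 4 show ?thesis by (simp add: rho_def rho_slope_def algebra_simps power2_eq_square)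
  qed
qed

lemma rho_slope_lipschitz:
  assumes \<psi>: "\<psi> \<in> Theta"
  obtains K where "K > 0" "\<And>s y. \<bar>rho_slope \<psi> s - rho_slope \<psi> y\<bar> \<le> K * \<bar>s - y\<bar>"
proof -
  obtain K where K: "K-lipschitz_on {0..} (right_deriv \<psi>)"
    using \<psi> unfolding Theta_def by blast
  then have K0: "K \<ge> 0" by (rule lipschitz_on_nonneg)
  have Kl: "\<bar>right_deriv \<psi> s - right_deriv \<psi> y\<bar> \<le> K * \<bar>s - y\<bar>" if "s \<ge> 0" "y \<ge> 0" for s y
    using lipschitz_onD[OF K, of s y] that by (simp add: dist_real_def)
  \<comment> \<open>The slope varies at rate at most \<open>K\<close> to the right of 0 and at rate
    2 to the left; \<open>K + 2\<close> also covers intervals containing 0.\<close>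
  have A: "\<bar>rho_slope \<psi> s - rho_slope \<psi> y\<bar> \<le> (K + 2) * \<bar>s - y\<bar>" if "s \<le> y" for s y
  proof -
    consider "0 \<le> s" | "s < 0" "0 \<le> y" | "y < 0" by linarith
    then show ?thesis
    proof cases
      case 1
      with that Kl[of s y] show ?thesis by (simp add: rho_slope_def algebra_simps)
    next
      case 2
      have "K * y \<le> K * (y - s)" "K * (y - s) \<ge> 0" using 2 K0 by (auto intro: mult_left_mono)
      with 2 Kl[of 0 y] show ?thesis by (simp add: rho_slope_def algebra_simps)
    next
      case 3
      have "K * (y - s) \<ge> 0" using that K0 by simp
      with 3 that show ?thesis by (simp add: rho_slope_def algebra_simps)
    qed
  qed
  have "\<bar>rho_slope \<psi> s - rho_slope \<psi> y\<bar> \<le> (K + 2) * \<bar>s - y\<bar>" for s y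
    using A[of s y] A[of y s] by (cases "s \<le> y") (auto simp: abs_minus_commute)
  with K0 show ?thesis by (intro that[of "K + 2"]) auto
qed

text \<open>The tangent inequality based at \<open>y\<close> and evaluated at \<open>s\<close>
  bounds the gap by a difference of slopes times \<open>y - s\<close>. This gives the constant
  \<open>K\<close> without integration.\<close>

lemma rho_quadratic_upper:
  assumes \<psi>: "\<psi> \<in> Theta"
    and K: "\<And>s y. \<bar>rho_slope \<psi> s - rho_slope \<psi> y\<bar> \<le> K * \<bar>s - y\<bar>"
  shows "rho \<psi> y \<le> rho \<psi> s + rho_slope \<psi> s * (y - s) + K * (y - s)\<^sup>2"
proof -
  have "rho \<psi> y - rho \<psi> s - rho_slope \<psi> s * (y - s) \<le> (rho_slope \<psi> y - rho_slope \<psi> s) * (y - s)"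
    using rho_tangent[OF \<psi>, where s=y and y=s] by (simp add: algebra_simps)
  also have "\<dots> \<le> \<bar>rho_slope \<psi> y - rho_slope \<psi> s\<bar> * \<bar>y - s\<bar>"
    by (metis abs_ge_self abs_mult)
  also have "\<dots> \<le> K * \<bar>y - s\<bar> * \<bar>y - s\<bar>"
    using K by (intro mult_right_mono) auto
  also have "\<dots> = K * (y - s)\<^sup>2" by (simp add: power2_eq_square)
  finally show ?thesis by simp
qed

lemma conjugate_ge: "ereal (u * s - f s) \<le> convex_conjugate f u"
  unfolding convex_conjugate_def by (rule SUP_upper2[of s]) auto

text \<open>Equality in the Fenchel inequality: by \<open>rho_tangent\<close> the supremum is
  attained at \<open>s\<close>.\<close>

lemma conjugate_rho_slope:
  assumes \<psi>: "\<psi> \<in> Theta"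
  shows "convex_conjugate (rho \<psi>) (rho_slope \<psi> s) = ereal (rho_slope \<psi> s * s - rho \<psi> s)"
proof (rule antisym)
  show "convex_conjugate (rho \<psi>) (rho_slope \<psi> s) \<le> ereal (rho_slope \<psi> s * s - rho \<psi> s)"
    unfolding convex_conjugate_def
  proof (rule SUP_least)
    fix y
    show "ereal (rho_slope \<psi> s \<bullet> y - rho \<psi> y) \<le> ereal (rho_slope \<psi> s * s - rho \<psi> s)"
      using rho_tangent[OF \<psi>, of s y] by (simp add: algebra_simps)
  qed
qed (rule conjugate_ge)

lemma conjugate_rho_nonneg:
  assumes "\<psi> \<in> Theta" shows "convex_conjugate (rho \<psi>) u \<ge> 0"
  using conjugate_ge[of u 0 "rho \<psi>"] assms by (simp add: rho_def zero_ereal_def)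

text \<open>For \<open>u \<ge> 0\<close> the finite conjugate would bound \<psi> on the whole
  half-line, against level-boundedness. The strict sign permits division by \<open>u\<close>
  later.\<close>

lemma conjugate_rho_finite_imp_neg:
  assumes \<psi>: "\<psi> \<in> Theta" and fin: "convex_conjugate (rho \<psi>) u = ereal c"
  shows "u < 0"
proof (rule ccontr)
  assume "\<not> u < 0"
  have "\<psi> s \<le> c" if "s \<ge> 0" for s
  proof -
    have "u * s + \<psi> s \<le> c"
      using conjugate_ge[of u s "rho \<psi>"] fin that by (simp add: rho_def)
    moreover have "u * s \<ge> 0" using \<open>\<not> u < 0\<close> that by simp
    ultimately show ?thesis by simp
  qed
  then have "{s. s \<ge> 0 \<and> \<psi> s \<le> c} = {0..}" by auto
  moreover have "bounded {s. s \<ge> 0 \<and> \<psi> s \<le> c}" using \<psi> unfolding Theta_def by blast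
  ultimately have "bounded {0::real..}" by simp
  then obtain B :: real where "\<And>x. x \<ge> 0 \<Longrightarrow> \<bar>x\<bar> \<le> B"
    by (auto simp: bounded_real)
  from this[of "\<bar>B\<bar> + 1"] show False by simp
qed

lemma conjugate_convex:
  fixes f :: "real \<Rightarrow> real"
  assumes "convex_conjugate f u = ereal a" "convex_conjugate f y = ereal b" "0 \<le> t" "t \<le> 1"
  shows "convex_conjugate f (u + t * (y - u)) \<le> ereal (a + t * (b - a))"
  unfolding convex_conjugate_def
proof (rule SUP_least)
  fix s
  have "u * s - f s \<le> a" "y * s - f s \<le> b"
    using conjugate_ge[of u s f] conjugate_ge[of y s f] assms by auto
  then have "(1 - t) * (u * s - f s) + t * (y * s - f s) \<le> (1 - t) * a + t * b"
    using assms(3,4) by (intro add_mono mult_left_mono) auto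
  then show "ereal ((u + t * (y - u)) \<bullet> s - f s) \<le> ereal (a + t * (b - a))"
    by (simp add: algebra_simps)
qed

text \<open>Testing the subgradient inequality only at \<open>y = \<rho>'(s)\<close>, where the conjugate is known,
  is enough to invert the subdifferential of \<open>\<rho>\<^sup>*\<close>.\<close>

lemma conjugate_rho_subgradient:
  assumes \<psi>: "\<psi> \<in> Theta" and c: "convex_conjugate (rho \<psi>) u = ereal c"
    and sub: "s * (rho_slope \<psi> s - u) \<le> rho_slope \<psi> s * s - rho \<psi> s - c"
  shows "u = rho_slope \<psi> s" "c = u * s - rho \<psi> s"
proof -
  have c_ge: "c \<ge> u * y - rho \<psi> y" for y
    using conjugate_ge[of u y "rho \<psi>"] c by simp
  have "c \<le> u * s - rho \<psi> s"
    using sub by (simp add: algebra_simps)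
  with c_ge[of s] show c_eq: "c = u * s - rho \<psi> s"
    by simp
  obtain K where K: "K > 0" "\<And>s y. \<bar>rho_slope \<psi> s - rho_slope \<psi> y\<bar> \<le> K * \<bar>s - y\<bar>"
    using rho_slope_lipschitz[OF \<psi>] by blast
  define w where "w = u - rho_slope \<psi> s"
  have *: "w * d \<le> K * d\<^sup>2" for d
    using c_ge[of "s + d"] c_eq rho_quadratic_upper[OF \<psi> K(2), of "s + d" s]
    by (simp add: w_def algebra_simps)
  \<comment> \<open>The choice \<open>d = w / (2 * K)\<close> maximizes
    \<open>w * d - K * d\<^sup>2\<close>, whose maximum is a positive multiple of
    \<open>w\<^sup>2\<close>.\<close>
  have "w * (w / (2 * K)) \<le> K * (w / (2 * K))\<^sup>2" by (rule *)
  then have "w\<^sup>2 \<le> 0"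
    using K(1) by (simp add: field_simps power2_eq_square)
  then show "u = rho_slope \<psi> s" by (simp add: w_def)
qed

section \<open>Squared distances and the gradient of \<open>\<Psi>\<close>\<close>

lemma infdist_eq_dist_closest_point:
  assumes "closed S" "S \<noteq> {}"
  shows "infdist x S = dist x (closest_point S x)"
proof -
  obtain y where "y \<in> S" "infdist x S = dist x y"
    using infdist_attains_inf[OF assms] by blast
  then show ?thesis
    using closest_point_le[OF assms(1), of y x]
      infdist_le[OF closest_point_in_set[OF assms, of x], of x]
    by linarith
qed

lemma norm_add_sq:
  fixes a b :: "'a::real_inner"
  shows "(norm (a + b))\<^sup>2 = (norm a)\<^sup>2 + 2 * (a \<bullet> b) + (norm b)\<^sup>2"
  by (simp add: power2_norm_eq_inner inner_add_left inner_add_right inner_commute)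

lemma eq_if_inner_le:
  fixes a b :: "'a::real_inner"
  assumes "\<And>e. a \<bullet> e \<le> b \<bullet> e"
  shows "a = b"
proof -
  have "(a - b) \<bullet> (a - b) \<le> 0"
    using assms[of "a - b"] by (simp only: inner_diff_left diff_le_0_iff_le)
  then have "(a - b) \<bullet> (a - b) = 0" using inner_ge_zero by (rule order_antisym)
  then show ?thesis by simp
qed

text \<open>Expand the square of \<open>y - ?q\<close> around \<open>x - ?p\<close>: the
  obtuse-angle property of the projection disposes of the cross term with \<open>?q - ?p\<close>,
  and the remaining square is nonnegative.\<close>

lemma infdist_sq_lower:
  fixes S :: "'a::euclidean_space set"
  assumes "closed S" "convex S" "S \<noteq> {}"
  shows "(infdist y S)\<^sup>2 \<ge> (infdist x S)\<^sup>2 + 2 * ((x - closest_point S x) \<bullet> (y - x))"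
proof -
  let ?p = "closest_point S x" and ?q = "closest_point S y"
  have "(x - ?p) \<bullet> (?q - ?p) \<le> 0"
    using closest_point_dot[OF assms(2,1) closest_point_in_set[OF assms(1,3)]] .
  moreover have "y - ?q = (x - ?p) + ((y - x) - (?q - ?p))" by simp
  then have "(norm (y - ?q))\<^sup>2 = (norm (x - ?p))\<^sup>2 + 2 * ((x - ?p) \<bullet> ((y - x) - (?q - ?p)))
      + (norm ((y - x) - (?q - ?p)))\<^sup>2"
    by (simp only: norm_add_sq)
  ultimately have "(norm (y - ?q))\<^sup>2 \<ge> (norm (x - ?p))\<^sup>2 + 2 * ((x - ?p) \<bullet> (y - x))"
    using zero_le_power2[of "norm ((y - x) - (?q - ?p))"]
      inner_diff_right[of "x - ?p" "y - x" "?q - ?p"]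
    by linarith
  then show ?thesis
    using assms by (simp add: infdist_eq_dist_closest_point dist_norm)
qed

text \<open>\<open>normal\<close> says that \<xi> is the projection of \<open>x + e\<close>. Adding
  the variational inequalities of the two projections and using Cauchy-Schwarz gives the first
  bound. Inserting it in the expansion of the squared distance makes the second error quadratic in
  \<open>e\<close>, not merely linear.\<close>

lemma projection_perturbation:
  fixes S :: "'a::euclidean_space set"
  assumes S: "closed S" "convex S" and \<xi>: "\<xi> \<in> S"
    and normal: "\<And>y. y \<in> S \<Longrightarrow> (x - \<xi> + e) \<bullet> (y - \<xi>) \<le> 0"
  shows "norm (\<xi> - closest_point S x) \<le> norm e"
    and "(norm (x - \<xi>))\<^sup>2 \<le> (infdist x S)\<^sup>2 + 2 * (norm e)\<^sup>2"
proof -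
  let ?p = "closest_point S x"
  have ne: "S \<noteq> {}" using \<xi> by auto
  have 1: "(x - \<xi> + e) \<bullet> (?p - \<xi>) \<le> 0"
    by (rule normal) (rule closest_point_in_set[OF S(1) ne])
  have 2: "(x - ?p) \<bullet> (\<xi> - ?p) \<le> 0"
    by (rule closest_point_dot[OF S(2,1) \<xi>])
  have e: "- (e \<bullet> (?p - \<xi>)) \<le> norm e * norm (?p - \<xi>)"
    using norm_cauchy_schwarz[of "- e" "?p - \<xi>"] by simp
  have "(norm (?p - \<xi>))\<^sup>2 \<le> - (e \<bullet> (?p - \<xi>))"
    using 1 2 by (simp add: power2_norm_eq_inner algebra_simps inner_commute)
  with e have "norm (?p - \<xi>) * norm (?p - \<xi>) \<le> norm e * norm (?p - \<xi>)"
    by (simp add: power2_eq_square)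
  then have le: "norm (?p - \<xi>) \<le> norm e"
    by (cases "norm (?p - \<xi>) = 0") auto
  then show "norm (\<xi> - ?p) \<le> norm e" by (simp add: norm_minus_commute)
  have "(norm (x - \<xi>))\<^sup>2 = (norm (x - ?p))\<^sup>2 + 2 * ((x - \<xi>) \<bullet> (?p - \<xi>)) - (norm (?p - \<xi>))\<^sup>2"
    by (simp add: power2_norm_eq_inner algebra_simps inner_commute)
  moreover have "(x - \<xi>) \<bullet> (?p - \<xi>) \<le> norm e * norm (?p - \<xi>)"
    using 1 e by (simp only: inner_add_left; linarith)
  moreover have "norm e * norm (?p - \<xi>) \<le> (norm e)\<^sup>2"
    unfolding power2_eq_square by (intro mult_left_mono le) simp
  ultimately have "(norm (x - \<xi>))\<^sup>2 \<le> (norm (x - ?p))\<^sup>2 + 2 * (norm e)\<^sup>2"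
    using zero_le_power2[of "norm (?p - \<xi>)"] by linarith
  then show "(norm (x - \<xi>))\<^sup>2 \<le> (infdist x S)\<^sup>2 + 2 * (norm e)\<^sup>2"
    by (simp add: infdist_eq_dist_closest_point[OF S(1) ne] dist_norm)
qed

text \<open>The gradient of \<Psi> by the chain rule; \<open>right_deriv\<close> makes the formula
  meaningful also on \<open>D i\<close>, where \<psi> is evaluated at 0.\<close>

definition Psi_grad :: "(real \<Rightarrow> real) \<Rightarrow> ('m::finite \<Rightarrow> (real^'n) set) \<Rightarrow> real^'n \<Rightarrow> real^'n" where
  "Psi_grad \<psi> D x =
     (\<Sum>i\<in>UNIV. (2 * right_deriv \<psi> ((infdist x (D i))\<^sup>2)) *\<^sub>R (x - closest_point (D i) x))"

text \<open>Bound \<psi> below by its tangent minus a quadratic error, then bound the squared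
  distance below by convexity. The positive slope \<sigma> allows the two bounds to be
  chained.\<close>

lemma Psi_grad_frechet:
  fixes D :: "'m::finite \<Rightarrow> (real^'n) set"
  assumes \<psi>: "\<psi> \<in> Theta" and D: "\<And>i. D i \<noteq> {}" "\<And>i. closed (D i)" "\<And>i. convex (D i)"
  shows "Psi_grad \<psi> D x \<in> frechet_subdiff (Psi \<psi> D) x"
proof -
  obtain K where K: "K > 0" "\<And>s y. \<bar>rho_slope \<psi> s - rho_slope \<psi> y\<bar> \<le> K * \<bar>s - y\<bar>"
    using rho_slope_lipschitz[OF \<psi>] by blast
  let ?g = "\<lambda>y. \<Sum>i\<in>UNIV. \<psi> ((infdist y (D i))\<^sup>2)"
  \<comment> \<open>For \<open>norm (y - x) \<le> 1\<close> the two distances sum to at most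
    \<open>2 * infdist x (D i) + 1\<close>; this factor controls the difference of their
    squares.\<close>
  let ?C = "\<lambda>i. K * (2 * infdist x (D i) + 1)\<^sup>2"
  have one: "\<psi> ((infdist y (D i))\<^sup>2) \<ge> \<psi> ((infdist x (D i))\<^sup>2)
      + ((2 * right_deriv \<psi> ((infdist x (D i))\<^sup>2)) *\<^sub>R (x - closest_point (D i) x)) \<bullet> (y - x)
      - ?C i * (norm (y - x))\<^sup>2"
    if y: "norm (y - x) \<le> 1" for y i
  proof -
    let ?d = "infdist x (D i)" and ?e = "infdist y (D i)"
    define \<sigma> where "\<sigma> = right_deriv \<psi> (?d\<^sup>2)"
    have "\<sigma> > 0" unfolding \<sigma>_def by (rule Theta_right_deriv_pos[OF \<psi>]) simp
    have "\<psi> (?e\<^sup>2) \<ge> \<psi> (?d\<^sup>2) + \<sigma> * (?e\<^sup>2 - ?d\<^sup>2) - K * (?e\<^sup>2 - ?d\<^sup>2)\<^sup>2"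
      using rho_quadratic_upper[OF \<psi> K(2), of "?e\<^sup>2" "?d\<^sup>2"] by (simp add: rho_def rho_slope_def \<sigma>_def)
    moreover have "\<sigma> * (2 * ((x - closest_point (D i) x) \<bullet> (y - x))) \<le> \<sigma> * (?e\<^sup>2 - ?d\<^sup>2)"
      using infdist_sq_lower[OF D(2,3,1), of x i y] \<open>\<sigma> > 0\<close> by (intro mult_left_mono) auto
    moreover have "K * (?e\<^sup>2 - ?d\<^sup>2)\<^sup>2 \<le> ?C i * (norm (y - x))\<^sup>2"
    proof -
      have ed: "\<bar>?e - ?d\<bar> \<le> norm (y - x)"
        using infdist_triangle[of x "D i" y] infdist_triangle[of y "D i" x]
        by (auto simp: dist_norm norm_minus_commute abs_le_iff)
      have "\<bar>?e\<^sup>2 - ?d\<^sup>2\<bar> = (?e + ?d) * \<bar>?e - ?d\<bar>"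
        by (simp add: power2_eq_square square_diff_square_factored abs_mult infdist_nonneg)
      also have "\<dots> \<le> (2 * ?d + 1) * norm (y - x)"
        using ed y by (intro mult_mono) (auto simp: infdist_nonneg)
      finally have "\<bar>?e\<^sup>2 - ?d\<^sup>2\<bar>\<^sup>2 \<le> ((2 * ?d + 1) * norm (y - x))\<^sup>2"
        by (intro power_mono) auto
      then show ?thesis using K(1) by (simp add: power_mult_distrib mult.assoc)
    qed
    ultimately show ?thesis by (simp add: \<sigma>_def mult.assoc mult.left_commute)
  qed
  have "eventually (\<lambda>y. norm (y - x) \<le> 1) (nhds x)"
    by (auto simp: eventually_nhds_metric dist_norm intro!: exI[of _ 1])
  then have "eventually (\<lambda>y. ?g y \<ge> ?g x + Psi_grad \<psi> D x \<bullet> (y - x) - (\<Sum>i\<in>UNIV. ?C i) * (norm (y - x))\<^sup>2) (nhds x)"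
  proof eventually_elim
    case (elim y)
    have "?g y \<ge> (\<Sum>i\<in>UNIV. \<psi> ((infdist x (D i))\<^sup>2)
      + ((2 * right_deriv \<psi> ((infdist x (D i))\<^sup>2)) *\<^sub>R (x - closest_point (D i) x)) \<bullet> (y - x)
      - ?C i * (norm (y - x))\<^sup>2)"
      by (rule sum_mono) (rule one[OF elim])
    then show ?case
      by (simp add: sum.distrib sum_subtractf Psi_grad_def inner_sum_left sum_distrib_right)
  qed
  then show ?thesis
    unfolding Psi_def by (rule quadratic_minorant_imp_frechet)
qed

section \<open>The potential \<open>frakM\<close>\<close>

lemma frakM_eq:
  assumes "\<And>i. \<xi> $ i \<in> D i" "\<And>i. convex_conjugate (rho \<psi>) (u $ i) = ereal (h i)"
  shows "frakM \<psi> D (x, \<xi>, u) = ereal (\<Sum>i\<in>UNIV. h i - u $ i * (norm (x - \<xi> $ i))\<^sup>2)"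
  by (simp add: frakM_def indicator_fun_def assms)

lemma frakM_finiteE:
  assumes \<psi>: "\<psi> \<in> Theta" and fin: "frakM \<psi> D (x, \<xi>, u) < \<infinity>"
  obtains h where "\<And>i. \<xi> $ i \<in> D i" "\<And>i. convex_conjugate (rho \<psi>) (u $ i) = ereal (h i)"
proof -
  let ?T = "\<lambda>i. convex_conjugate (rho \<psi>) (u $ i) - ereal (u $ i * (norm (x - \<xi> $ i))\<^sup>2)
       + indicator_fun (D i) (\<xi> $ i)"
  have "(\<Sum>i\<in>UNIV. ?T i) \<noteq> \<infinity>" using fin by (auto simp: frakM_def)
  then have T: "?T i \<noteq> \<infinity>" for i by (simp add: sum_Pinfty)
  have "\<xi> $ i \<in> D i \<and> (\<exists>h. convex_conjugate (rho \<psi>) (u $ i) = ereal h)" for i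
    using T[of i] conjugate_rho_nonneg[OF \<psi>, of "u $ i"]
    by (cases "convex_conjugate (rho \<psi>) (u $ i)") (auto simp: indicator_fun_def split: if_splits)
  then show ?thesis using that by metis
qed

lemma frakM_not_MInf:
  assumes \<psi>: "\<psi> \<in> Theta" shows "frakM \<psi> D z \<noteq> - \<infinity>"
proof
  assume *: "frakM \<psi> D z = - \<infinity>"
  obtain x \<xi> u where z: "z = (x, \<xi>, u)" by (metis prod_cases3)
  with * obtain h where "\<And>i. \<xi> $ i \<in> D i" "\<And>i. convex_conjugate (rho \<psi>) (u $ i) = ereal (h i)"
    by (auto intro: frakM_finiteE[OF \<psi>, of D x \<xi> u])
  from frakM_eq[OF this, of x] * z show False by simp
qed

section \<open>Properness and lower semicontinuity of the potential\<close>

lemma frakM_proper: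
  fixes D :: "'m::finite \<Rightarrow> (real^'n) set"
  assumes \<psi>: "\<psi> \<in> Theta" and D: "\<And>i. D i \<noteq> {}"
  shows "proper (frakM \<psi> D)"
proof -
  have "\<forall>i. \<exists>p. p \<in> D i" using D by auto
  then obtain p where p: "\<And>i. p i \<in> D i" by metis
  \<comment> \<open>Slopes of \<open>rho \<psi>\<close> are points where the conjugate is known to
    be finite.\<close>
  have "frakM \<psi> D (0, (\<chi> i. p i), (\<chi> i. rho_slope \<psi> 0)) < \<infinity>"
    by (subst frakM_eq) (auto simp: p conjugate_rho_slope[OF \<psi>])
  then have "dom (frakM \<psi> D) \<noteq> {}" by (auto simp: dom_def)
  with frakM_not_MInf[OF \<psi>] show ?thesis by (auto simp: proper_def)
qed

lemma Liminf_sum_ge: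
  fixes f :: "'i \<Rightarrow> 'a \<Rightarrow> ereal"
  assumes F: "F \<noteq> bot" and "finite I" "\<And>i x. i \<in> I \<Longrightarrow> 0 \<le> f i x"
    "\<And>i. i \<in> I \<Longrightarrow> a i \<le> Liminf F (f i)"
  shows "(\<Sum>i\<in>I. a i) \<le> Liminf F (\<lambda>x. \<Sum>i\<in>I. f i x)"
  using assms(2-4)
proof (induction I rule: finite_induct)
  case empty
  then show ?case using F by (simp add: Liminf_const)
next
  case (insert i I)
  have "a i + sum a I \<le> Liminf F (f i) + Liminf F (\<lambda>x. \<Sum>i\<in>I. f i x)"
    using insert by (intro add_mono) auto
  also have "\<dots> \<le> Liminf F (\<lambda>x. f i x + (\<Sum>i\<in>I. f i x))"
    using insert.prems F by (intro Liminf_add_le) (auto intro!: always_eventually sum_nonneg)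
  finally show ?case using insert.hyps by simp
qed

text \<open>A supremum of affine functions: one \<open>s\<close> that beats \<open>c\<close> at the
  limit point still beats it nearby, by continuity for fixed \<open>s\<close>.\<close>

lemma conjugate_minus_lsc:
  fixes f :: "real \<Rightarrow> real"
  assumes "(g \<longlongrightarrow> u) F" "(k \<longlongrightarrow> l) F"
  shows "convex_conjugate f u - ereal l \<le> Liminf F (\<lambda>z. convex_conjugate f (g z) - ereal (k z))"
  unfolding le_Liminf_iff
proof (intro allI impI)
  fix c assume "c < convex_conjugate f u - ereal l"
  then have "c + ereal l < convex_conjugate f u" by (simp add: ereal_less_minus)
  then obtain s where "c + ereal l < ereal (u * s - f s)"
    by (auto simp: convex_conjugate_def less_SUP_iff mult.commute)
  then have s: "c < ereal (u * s - f s - l)" by (cases c) auto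
  have "((\<lambda>z. ereal (g z * s - f s - k z)) \<longlongrightarrow> ereal (u * s - f s - l)) F"
    by (intro tendsto_intros assms)
  then have "eventually (\<lambda>z. c < ereal (g z * s - f s - k z)) F"
    using s by (rule order_tendstoD)
  then show "eventually (\<lambda>z. c < convex_conjugate f (g z) - ereal (k z)) F"
  proof eventually_elim
    case (elim z)
    also have "ereal (g z * s - f s - k z) = ereal (g z * s - f s) - ereal (k z)" by simp
    also have "\<dots> \<le> convex_conjugate f (g z) - ereal (k z)"
      by (intro ereal_minus_mono conjugate_ge order_refl)
    finally show ?case .
  qed
qed

text \<open>Testing the conjugate at \<open>s = r\<close> cancels the coupling term. This serves
  both for nonnegativity of the summands and for comparing \<Psi> with \<open>frakM\<close>.\<close>

lemma conjugate_rho_minus_ge: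
  assumes \<psi>: "\<psi> \<in> Theta" and "r \<ge> 0"
  shows "convex_conjugate (rho \<psi>) u - ereal (u * r) \<ge> ereal (\<psi> r)"
  using ereal_minus_mono[OF conjugate_ge[of u r "rho \<psi>"], of "ereal (u * r)" "ereal (u * r)"] assms(2)
  by (simp add: rho_def)

lemma indicator_lsc:
  assumes "closed S" "(g \<longlongrightarrow> p) F"
  shows "indicator_fun S p \<le> Liminf F (\<lambda>z. indicator_fun S (g z))"
proof (cases "p \<in> S")
  case True
  have "eventually (\<lambda>z. indicator_fun S p \<le> indicator_fun S (g z)) F"
    using True by (intro always_eventually) (auto simp: indicator_fun_def)
  then show ?thesis by (rule Liminf_bounded)
next
  case False
  then have "eventually (\<lambda>z. g z \<in> - S) F"
    using assms by (intro topological_tendstoD) auto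
  then have "eventually (\<lambda>z. indicator_fun S p \<le> indicator_fun S (g z)) F"
    by eventually_elim (auto simp: indicator_fun_def)
  then show ?thesis by (rule Liminf_bounded)
qed

text \<open>The coupling term is kept together with the conjugate, since that group is nonnegative;
  nonnegativity lets lower limits be added without indeterminate sums.\<close>

lemma frakM_closed:
  fixes D :: "'m::finite \<Rightarrow> (real^'n) set"
  assumes \<psi>: "\<psi> \<in> Theta" and D: "\<And>i. closed (D i)"
  shows "closed_fun (frakM \<psi> D)"
  unfolding closed_fun_def
proof
  fix z :: "(real^'n) \<times> (real^'n^'m) \<times> (real^'m)"
  let ?u = "\<lambda>z::(real^'n) \<times> (real^'n^'m) \<times> (real^'m). snd (snd z)"
  let ?\<xi> = "\<lambda>z::(real^'n) \<times> (real^'n^'m) \<times> (real^'m). fst (snd z)"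
  let ?k = "\<lambda>i z. ?u z $ i * (norm (fst z - ?\<xi> z $ i))\<^sup>2"
  let ?c = "\<lambda>i z. convex_conjugate (rho \<psi>) (?u z $ i) - ereal (?k i z)"
  let ?d = "\<lambda>i z. indicator_fun (D i) (?\<xi> z $ i)"
  have eq: "frakM \<psi> D = (\<lambda>z. \<Sum>i\<in>UNIV. ?c i z + ?d i z)"
    by (auto simp: frakM_def fun_eq_iff)
  have nonneg: "0 \<le> ?c i z" "0 \<le> ?d i z" for i z
  proof -
    have "0 \<le> ereal (\<psi> ((norm (fst z - ?\<xi> z $ i))\<^sup>2))"
      using Theta_mono[OF \<psi>, of 0 "(norm (fst z - ?\<xi> z $ i))\<^sup>2"] \<psi> by simp
    also have "\<dots> \<le> ?c i z" by (rule conjugate_rho_minus_ge[OF \<psi>]) simp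
    finally show "0 \<le> ?c i z" .
  qed (simp add: indicator_fun_def)
  have "?c i z + ?d i z \<le> Liminf (at z) (\<lambda>z. ?c i z + ?d i z)" for i
  proof -
    have "?c i z + ?d i z \<le> Liminf (at z) (?c i) + Liminf (at z) (?d i)"
      by (intro add_mono conjugate_minus_lsc indicator_lsc D tendsto_intros)
    also have "\<dots> \<le> Liminf (at z) (\<lambda>z. ?c i z + ?d i z)"
      using nonneg by (intro Liminf_add_le always_eventually) auto
    finally show ?thesis .
  qed
  then show "frakM \<psi> D z \<le> Liminf (at z) (frakM \<psi> D)"
    unfolding eq using nonneg by (intro Liminf_sum_ge) auto
qed

section \<open>First-order conditions for Frechet subgradients\<close>

text \<open>Each claim tests the subgradient along a block direction. Moves in \<open>x\<close> are
  unrestricted and give an equation; moves of \<xi> towards \<open>y\<close> stay feasible by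
  convexity; moves of \<open>u\<close> go towards a point where the conjugate is known.\<close>

lemma frakM_frechetD:
  fixes D :: "'m::finite \<Rightarrow> (real^'n) set"
  assumes \<psi>: "\<psi> \<in> Theta" and D: "\<And>i. convex (D i)"
    and \<xi>: "\<And>i. \<xi> $ i \<in> D i" and h: "\<And>i. convex_conjugate (rho \<psi>) (u $ i) = ereal (h i)"
    and v: "(vx, v\<xi>, vu) \<in> frechet_subdiff (frakM \<psi> D) (x, \<xi>, u)"
  shows "vx = (\<Sum>i\<in>UNIV. (- 2 * u $ i) *\<^sub>R (x - \<xi> $ i))"
    and "y \<in> D i \<Longrightarrow> (v\<xi> $ i - (2 * u $ i) *\<^sub>R (x - \<xi> $ i)) \<bullet> (y - \<xi> $ i) \<le> 0"
    and "u $ i = rho_slope \<psi> ((norm (x - \<xi> $ i))\<^sup>2 + vu $ i)"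
    and "h i = u $ i * ((norm (x - \<xi> $ i))\<^sup>2 + vu $ i) - rho \<psi> ((norm (x - \<xi> $ i))\<^sup>2 + vu $ i)"
proof -
  let ?F = "\<Sum>i\<in>UNIV. h i - u $ i * (norm (x - \<xi> $ i))\<^sup>2"
  have F: "frakM \<psi> D (x, \<xi>, u) = ereal ?F" by (rule frakM_eq[OF \<xi> h])
  note dir = frechet_subdiff_direction[OF v F]
  have sq: "(norm (a + t *\<^sub>R b))\<^sup>2 = (norm a)\<^sup>2 + 2 * t * (a \<bullet> b) + t\<^sup>2 * (norm b)\<^sup>2"
    for a b :: "real^'n" and t
    by (simp add: norm_add_sq power_mult_distrib)

  have "vx \<bullet> e \<le> (\<Sum>i\<in>UNIV. (- 2 * u $ i) *\<^sub>R (x - \<xi> $ i)) \<bullet> e" for e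
  proof -
    have "(vx, v\<xi>, vu) \<bullet> (e, 0, 0) \<le> (\<Sum>i\<in>UNIV. (- 2 * u $ i) *\<^sub>R (x - \<xi> $ i)) \<bullet> e"
    proof (rule dir[where B="\<Sum>i\<in>UNIV. - u $ i * (norm e)\<^sup>2"])
      fix t :: real
      have "x + t *\<^sub>R e - \<xi> $ i = (x - \<xi> $ i) + t *\<^sub>R e" for i by simp
      then have n: "(norm (x + t *\<^sub>R e - \<xi> $ i))\<^sup>2
          = (norm (x - \<xi> $ i))\<^sup>2 + 2 * t * ((x - \<xi> $ i) \<bullet> e) + t\<^sup>2 * (norm e)\<^sup>2" for i
        by (simp only: sq)
      have "frakM \<psi> D (x + t *\<^sub>R e, \<xi>, u) = ereal (\<Sum>i\<in>UNIV. h i - u $ i * (norm (x - \<xi> $ i))\<^sup>2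
          + t * ((- 2 * u $ i) * ((x - \<xi> $ i) \<bullet> e)) + t\<^sup>2 * (- u $ i * (norm e)\<^sup>2))"
        by (simp only: frakM_eq[OF \<xi> h] n) (simp add: algebra_simps)
      also have "\<dots> = ereal (?F + t * ((\<Sum>i\<in>UNIV. (- 2 * u $ i) *\<^sub>R (x - \<xi> $ i)) \<bullet> e)
          + t\<^sup>2 * (\<Sum>i\<in>UNIV. - u $ i * (norm e)\<^sup>2))"
        by (simp only: sum.distrib sum_distrib_left inner_sum_left inner_scaleR_left)
      finally show "frakM \<psi> D ((x, \<xi>, u) + t *\<^sub>R (e, 0, 0)) \<le> \<dots>" by simp
    qed
    then show ?thesis by simp
  qed
  then show "vx = (\<Sum>i\<in>UNIV. (- 2 * u $ i) *\<^sub>R (x - \<xi> $ i))"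
    by (rule eq_if_inner_le)

  show "(v\<xi> $ i - (2 * u $ i) *\<^sub>R (x - \<xi> $ i)) \<bullet> (y - \<xi> $ i) \<le> 0" if y: "y \<in> D i"
  proof -
    let ?d = "y - \<xi> $ i"
    have "(vx, v\<xi>, vu) \<bullet> (0, axis i ?d, 0) \<le> 2 * u $ i * ((x - \<xi> $ i) \<bullet> ?d)"
    proof (rule dir[where B="- u $ i * (norm ?d)\<^sup>2"])
      fix t :: real assume t: "0 < t" "t \<le> 1"
      define \<xi>' where "\<xi>' = \<xi> + t *\<^sub>R axis i ?d"
      have nth: "\<xi>' $ j = (if j = i then \<xi> $ i + t *\<^sub>R ?d else \<xi> $ j)" for j
        by (simp add: \<xi>'_def axis_def)
      have "\<xi> $ i + t *\<^sub>R ?d = (1 - t) *\<^sub>R \<xi> $ i + t *\<^sub>R y" by (simp add: algebra_simps)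
      also have "\<dots> \<in> D i" using D \<xi> y t by (intro convexD_alt) auto
      finally have "\<xi>' $ j \<in> D j" for j using \<xi> by (auto simp: nth)
      then have "frakM \<psi> D (x, \<xi>', u) = ereal (\<Sum>j\<in>UNIV. h j - u $ j * (norm (x - \<xi>' $ j))\<^sup>2)"
        by (rule frakM_eq[OF _ h])
      also have "(\<Sum>j\<in>UNIV. h j - u $ j * (norm (x - \<xi>' $ j))\<^sup>2) =
        (\<Sum>j\<in>UNIV. h j - u $ j * (norm (x - \<xi> $ j))\<^sup>2
          + (if j = i then t * (2 * u $ i * ((x - \<xi> $ i) \<bullet> ?d)) + t\<^sup>2 * (- u $ i * (norm ?d)\<^sup>2) else 0))"
      proof (rule sum.cong)
        fix j
        have "x - (\<xi> $ i + t *\<^sub>R ?d) = (x - \<xi> $ i) + (- t) *\<^sub>R ?d" by (simp add: algebra_simps)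
        then have n: "(norm (x - (\<xi> $ i + t *\<^sub>R ?d)))\<^sup>2
            = (norm (x - \<xi> $ i))\<^sup>2 + 2 * (- t) * ((x - \<xi> $ i) \<bullet> ?d) + (- t)\<^sup>2 * (norm ?d)\<^sup>2"
          by (simp only: sq)
        show "h j - u $ j * (norm (x - \<xi>' $ j))\<^sup>2 = h j - u $ j * (norm (x - \<xi> $ j))\<^sup>2
          + (if j = i then t * (2 * u $ i * ((x - \<xi> $ i) \<bullet> ?d)) + t\<^sup>2 * (- u $ i * (norm ?d)\<^sup>2) else 0)"
        proof (cases "j = i")
          case True
          then have "(norm (x - \<xi>' $ j))\<^sup>2
            = (norm (x - \<xi> $ i))\<^sup>2 + 2 * (- t) * ((x - \<xi> $ i) \<bullet> ?d) + (- t)\<^sup>2 * (norm ?d)\<^sup>2"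
            unfolding nth n[symmetric] by simp
          then show ?thesis
            by (simp only: True if_True simp_thms) (simp add: algebra_simps)
        qed (simp add: nth)
      qed simp
      finally show "frakM \<psi> D ((x, \<xi>, u) + t *\<^sub>R (0, axis i ?d, 0))
          \<le> ereal (?F + t * (2 * u $ i * ((x - \<xi> $ i) \<bullet> ?d)) + t\<^sup>2 * (- u $ i * (norm ?d)\<^sup>2))"
        by (simp add: \<xi>'_def sum.distrib add.assoc)
    qed
    then show ?thesis by (simp add: inner_axis inner_diff_left)
  qed

  define r where "r = (norm (x - \<xi> $ i))\<^sup>2"
  \<comment> \<open>The coupling contributes \<open>- r\<close> to the derivative in
    \<open>u $ i\<close>, so \<open>s\<close> is the candidate subgradient of the conjugate. Moving
    towards \<open>rho_slope \<psi> s\<close> yields the single test required by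
    \<open>conjugate_rho_subgradient\<close>.\<close>
  define s where "s = r + vu $ i"
  let ?d = "rho_slope \<psi> s - u $ i"
  let ?A = "(rho_slope \<psi> s * s - rho \<psi> s) - h i - ?d * r"
  have "(vx, v\<xi>, vu) \<bullet> (0, 0, axis i ?d) \<le> ?A"
  proof (rule dir[where B=0])
    fix t :: real assume t: "0 < t" "t \<le> 1"
    define u' where "u' = u + t *\<^sub>R axis i ?d"
    have nth: "u' $ j = (if j = i then u $ i + t * ?d else u $ j)" for j
      by (simp add: u'_def axis_def)
    have le: "convex_conjugate (rho \<psi>) (u $ i + t * ?d) \<le> ereal (h i + t * (rho_slope \<psi> s * s - rho \<psi> s - h i))"
      using t by (intro conjugate_convex h conjugate_rho_slope[OF \<psi>]) auto
    then obtain c where c: "convex_conjugate (rho \<psi>) (u $ i + t * ?d) = ereal c"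
      using conjugate_rho_nonneg[OF \<psi>, of "u $ i + t * ?d"]
      by (cases "convex_conjugate (rho \<psi>) (u $ i + t * ?d)") auto
    have c_le: "c \<le> h i + t * (rho_slope \<psi> s * s - rho \<psi> s - h i)" using le c by simp
    have "convex_conjugate (rho \<psi>) (u' $ j) = ereal (if j = i then c else h j)" for j
      using c h by (auto simp: nth)
    then have eq: "frakM \<psi> D (x, \<xi>, u') = ereal (\<Sum>j\<in>UNIV. (if j = i then c else h j) - u' $ j * (norm (x - \<xi> $ j))\<^sup>2)"
      by (rule frakM_eq[OF \<xi>])
    have "(\<Sum>j\<in>UNIV. (if j = i then c else h j) - u' $ j * (norm (x - \<xi> $ j))\<^sup>2)
        \<le> (\<Sum>j\<in>UNIV. h j - u $ j * (norm (x - \<xi> $ j))\<^sup>2 + (if j = i then t * ?A else 0))"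
      using c_le by (intro sum_mono) (auto simp: nth r_def algebra_simps)
    also have "\<dots> = ?F + t * ?A" by (simp only: sum.distrib) simp
    finally have "frakM \<psi> D (x, \<xi>, u') \<le> ereal (?F + t * ?A)" by (simp only: eq ereal_less_eq)
    then show "frakM \<psi> D ((x, \<xi>, u) + t *\<^sub>R (0, 0, axis i ?d)) \<le> ereal (?F + t * ?A + t\<^sup>2 * 0)"
      by (simp add: u'_def)
  qed
  then have "s * (rho_slope \<psi> s - u $ i) \<le> rho_slope \<psi> s * s - rho \<psi> s - h i"
    by (simp add: inner_axis s_def algebra_simps)
  from conjugate_rho_subgradient[OF \<psi> h this]
  show "u $ i = rho_slope \<psi> ((norm (x - \<xi> $ i))\<^sup>2 + vu $ i)"
    and "h i = u $ i * ((norm (x - \<xi> $ i))\<^sup>2 + vu $ i) - rho \<psi> ((norm (x - \<xi> $ i))\<^sup>2 + vu $ i)"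
    by (simp_all add: s_def r_def)
qed

section \<open>Comparison with \<Psi> and transfer of the KL inequality\<close>

lemma Psi_le_frakM:
  fixes D :: "'m::finite \<Rightarrow> (real^'n) set"
  assumes \<psi>: "\<psi> \<in> Theta"
  shows "Psi \<psi> D x \<le> frakM \<psi> D (x, \<xi>, u)"
proof (cases "frakM \<psi> D (x, \<xi>, u) < \<infinity>")
  case True
  then obtain h where \<xi>: "\<And>i. \<xi> $ i \<in> D i" and h: "\<And>i. convex_conjugate (rho \<psi>) (u $ i) = ereal (h i)"
    by (rule frakM_finiteE[OF \<psi>]) blast
  have "\<psi> ((infdist x (D i))\<^sup>2) \<le> h i - u $ i * (norm (x - \<xi> $ i))\<^sup>2" for i
  proof -
    have "infdist x (D i) \<le> norm (x - \<xi> $ i)"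
      using infdist_le[OF \<xi>, of x i] by (simp add: dist_norm)
    then have "\<psi> ((infdist x (D i))\<^sup>2) \<le> \<psi> ((norm (x - \<xi> $ i))\<^sup>2)"
      by (intro Theta_mono[OF \<psi>] power_mono) (auto simp: infdist_nonneg)
    also have "\<dots> \<le> h i - u $ i * (norm (x - \<xi> $ i))\<^sup>2"
      using conjugate_rho_minus_ge[OF \<psi>, of "(norm (x - \<xi> $ i))\<^sup>2" "u $ i"] h[of i] by simp
    finally show ?thesis .
  qed
  then show ?thesis by (simp add: frakM_eq[OF \<xi> h] Psi_def sum_mono)
qed simp

text \<open>One index of the sum. The value error is quadratic in \<open>n\<close>: replacing
  \<open>s\<close> by \<open>r\<close> costs \<open>K * b\<^sup>2\<close>, and replacing
  \<open>r\<close> by \<open>q\<close> costs the slope times the quadratic projection error. The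
  gradient error is only linear in \<open>n\<close>.\<close>

lemma frakM_block_estimate:
  fixes S :: "'a::euclidean_space set"
  assumes \<psi>: "\<psi> \<in> Theta"
    and K: "\<And>s y. \<bar>rho_slope \<psi> s - rho_slope \<psi> y\<bar> \<le> K * \<bar>s - y\<bar>" and K0: "K > 0"
    and S: "closed S" "convex S" and \<xi>: "\<xi> \<in> S"
    and \<delta>: "0 < \<delta>" "u < - \<delta>" and R: "norm (x - \<xi>) \<le> R"
    and n: "norm w \<le> n" "\<bar>b\<bar> \<le> n" "n \<le> 1"
    and normal: "\<And>y. y \<in> S \<Longrightarrow> (w - (2 * u) *\<^sub>R (x - \<xi>)) \<bullet> (y - \<xi>) \<le> 0"
    and u: "u = rho_slope \<psi> ((norm (x - \<xi>))\<^sup>2 + b)"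
    and h: "h = u * ((norm (x - \<xi>))\<^sup>2 + b) - rho \<psi> ((norm (x - \<xi>))\<^sup>2 + b)"
  shows "h - u * (norm (x - \<xi>))\<^sup>2
      \<le> \<psi> ((infdist x S)\<^sup>2) + (right_deriv \<psi> 0 / (2 * \<delta>\<^sup>2) + K) * n\<^sup>2"
    and "norm ((2 * right_deriv \<psi> ((infdist x S)\<^sup>2)) *\<^sub>R (x - closest_point S x) - (- 2 * u) *\<^sub>R (x - \<xi>))
      \<le> (2 * K * R * (1 + 1 / (2 * \<delta>\<^sup>2)) + right_deriv \<psi> 0 / \<delta>) * n"
proof -
  let ?l = "right_deriv \<psi> 0"
  define r where "r = (norm (x - \<xi>))\<^sup>2"
  define q where "q = (infdist x S)\<^sup>2"
  define s where "s = r + b"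
  define p where "p = closest_point S x"
  \<comment> \<open>Dividing the normality condition by \<open>- 2 * u > 2 * \<delta>\<close> shows
    that \<xi> is the projection of \<open>x + e\<close>.\<close>
  define e where "e = (1 / (- 2 * u)) *\<^sub>R w"
  have l: "?l > 0" by (rule Theta_right_deriv_pos[OF \<psi>]) simp
  have R0: "R \<ge> 0" using R norm_ge_zero order_trans by blast
  have n0: "n \<ge> 0" using n(2) by linarith
  have "norm e = norm w / (- 2 * u)" using \<delta> by (simp add: e_def)
  also have "\<dots> \<le> n / (2 * \<delta>)" using n \<delta> by (intro frac_le) auto
  finally have e: "norm e \<le> n / (2 * \<delta>)" .
  have e2: "2 * (norm e)\<^sup>2 \<le> n\<^sup>2 / (2 * \<delta>\<^sup>2)"
    using power_mono[OF e norm_ge_zero, of 2] \<delta> by (simp add: power2_eq_square field_simps)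
  have "(x - \<xi> + e) \<bullet> (y - \<xi>) \<le> 0" if "y \<in> S" for y
  proof -
    have "x - \<xi> + e = (1 / (- 2 * u)) *\<^sub>R (w - (2 * u) *\<^sub>R (x - \<xi>))"
      using \<delta> by (simp add: e_def algebra_simps)
    then have "(x - \<xi> + e) \<bullet> (y - \<xi>) = (1 / (- 2 * u)) * ((w - (2 * u) *\<^sub>R (x - \<xi>)) \<bullet> (y - \<xi>))"
      by (simp only: inner_scaleR_left)
    also have "\<dots> \<le> 0" using normal[OF that] \<delta> by (intro mult_nonneg_nonpos) auto
    finally show ?thesis .
  qed
  from projection_perturbation[OF S \<xi> this]
  have pe: "norm (\<xi> - p) \<le> norm e" and rq: "r \<le> q + 2 * (norm e)\<^sup>2"
    by (simp_all add: p_def r_def q_def)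
  have "infdist x S \<le> norm (x - \<xi>)" using infdist_le[OF \<xi>, of x] by (simp add: dist_norm)
  then have qr: "q \<le> r" unfolding q_def r_def by (intro power_mono) (auto simp: infdist_nonneg)
  have q0: "q \<ge> 0" and r0: "r \<ge> 0" by (simp_all add: q_def r_def)
  have b2: "b\<^sup>2 \<le> n\<^sup>2" using n(2) power_mono[of "\<bar>b\<bar>" n 2] by simp
  have us: "u = rho_slope \<psi> s" using u by (simp add: s_def r_def)
  have sq: "rho_slope \<psi> q = - right_deriv \<psi> q" using q0 by (simp add: rho_slope_def)
  have sl: "right_deriv \<psi> q \<le> ?l" "right_deriv \<psi> q > 0"
    using Theta_right_deriv_le[OF \<psi> q0] Theta_right_deriv_pos[OF \<psi> q0] by auto

  have "h - u * r = u * b - rho \<psi> s"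
    using h by (simp add: s_def r_def algebra_simps)
  also have "\<dots> \<le> \<psi> r + K * b\<^sup>2"
    using rho_quadratic_upper[OF \<psi> K, of r s] r0 by (simp add: rho_def[of \<psi> r] us s_def)
  also have "\<dots> \<le> \<psi> q + right_deriv \<psi> q * (r - q) + K * n\<^sup>2"
    using Theta_tangent[OF \<psi> q0 r0] b2 K0 by (intro add_mono mult_left_mono) auto
  also have "right_deriv \<psi> q * (r - q) \<le> ?l * (n\<^sup>2 / (2 * \<delta>\<^sup>2))"
    using sl rq e2 qr l by (intro mult_mono) auto
  finally have "h - u * r \<le> \<psi> q + (?l / (2 * \<delta>\<^sup>2) + K) * n\<^sup>2"
    by (simp add: algebra_simps)
  then show "h - u * (norm (x - \<xi>))\<^sup>2
      \<le> \<psi> ((infdist x S)\<^sup>2) + (?l / (2 * \<delta>\<^sup>2) + K) * n\<^sup>2"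
    by (simp add: r_def q_def)

  \<comment> \<open>A linear bound suffices for the gradient, so \<open>n \<le> 1\<close> is used to
    weaken the quadratic projection error.\<close>
  have nn: "n\<^sup>2 \<le> n" using n0 n(3) by (simp add: power2_eq_square mult_left_le)
  have "n\<^sup>2 / (2 * \<delta>\<^sup>2) \<le> n / (2 * \<delta>\<^sup>2)" using nn by (intro divide_right_mono) auto
  then have "\<bar>s - q\<bar> \<le> n * (1 + 1 / (2 * \<delta>\<^sup>2))"
    using rq qr e2 n(2) by (simp add: s_def algebra_simps)
  then have usq: "\<bar>u - rho_slope \<psi> q\<bar> \<le> K * (n * (1 + 1 / (2 * \<delta>\<^sup>2)))"
    unfolding us using K[of s q] K0 by (meson mult_left_mono order_trans less_imp_le)
  \<comment> \<open>Split into a slope error acting on \<open>x - \<xi>\<close> and a projection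
    error acting on \<open>\<xi> - p\<close>.\<close>
  have "(2 * right_deriv \<psi> q) *\<^sub>R (x - p) - (- 2 * u) *\<^sub>R (x - \<xi>)
      = (2 * (u - rho_slope \<psi> q)) *\<^sub>R (x - \<xi>) + (2 * right_deriv \<psi> q) *\<^sub>R (\<xi> - p)"
    unfolding sq by (simp add: algebra_simps)
  also have "norm \<dots> \<le> 2 * \<bar>u - rho_slope \<psi> q\<bar> * norm (x - \<xi>) + 2 * right_deriv \<psi> q * norm (\<xi> - p)"
    using sl by (intro norm_triangle_le) (simp add: abs_mult del: right_diff_distrib_numeral)
  also have "\<dots> \<le> 2 * (K * (n * (1 + 1 / (2 * \<delta>\<^sup>2)))) * R + 2 * ?l * (n / (2 * \<delta>))"
    using usq R sl l pe e R0 K0 n0 by (intro add_mono mult_mono) auto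
  also have "\<dots> = (2 * K * R * (1 + 1 / (2 * \<delta>\<^sup>2)) + ?l / \<delta>) * n"
    using \<delta> by (simp add: field_simps)
  finally show "norm ((2 * right_deriv \<psi> ((infdist x S)\<^sup>2)) *\<^sub>R (x - closest_point S x) - (- 2 * u) *\<^sub>R (x - \<xi>))
      \<le> (2 * K * R * (1 + 1 / (2 * \<delta>\<^sup>2)) + ?l / \<delta>) * n"
    by (simp add: q_def p_def)
qed

text \<open>Bound the sum by twice the larger term. As \<open>2 * \<theta> \<ge> 1\<close> and
  \<open>n \<le> 1\<close>, the quadratic term raised to the power \<theta> is at most linear in
  \<open>n\<close>.\<close>

lemma powr_add_quadratic_le:
  fixes r a n A B \<theta> :: real
  assumes \<theta>: "1/2 \<le> \<theta>" "\<theta> < 1" and r: "0 < r" "r \<le> a + B * n\<^sup>2" and a: "0 \<le> a" "a powr \<theta> \<le> A * n"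
    and n: "0 \<le> n" "n \<le> 1" and B: "0 \<le> B"
  shows "r powr \<theta> \<le> 2 * (A + B powr \<theta>) * n"
proof -
  define m where "m = max a (B * n\<^sup>2)"
  have m: "0 \<le> m" "r \<le> 2 * m" using r a by (auto simp: m_def)
  have "(n\<^sup>2) powr \<theta> \<le> n"
  proof (cases "n = 0")
    case False
    then have "(n\<^sup>2) powr \<theta> = n powr (2 * \<theta>)"
      using n by (simp add: powr_powr flip: powr_numeral)
    also have "\<dots> \<le> n powr 1" using n \<theta> False by (intro powr_mono') auto
    finally show ?thesis using n by simp
  qed simp
  then have Bn: "(B * n\<^sup>2) powr \<theta> \<le> B powr \<theta> * n"
    using B by (simp add: powr_mult mult_left_mono)
  have "r powr \<theta> \<le> (2 * m) powr \<theta>" using r m \<theta> by (intro powr_mono2) auto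
  also have "\<dots> = 2 powr \<theta> * m powr \<theta>" using m by (simp add: powr_mult)
  also have "\<dots> \<le> 2 powr 1 * (a powr \<theta> + (B * n\<^sup>2) powr \<theta>)"
    using \<theta> by (intro mult_mono powr_mono) (auto simp: m_def max_def)
  also have "\<dots> \<le> 2 * (A * n + B powr \<theta> * n)" using a(2) Bn by simp
  finally show ?thesis by (simp add: algebra_simps)
qed

lemma frakM_KL_at:
  fixes D :: "'m::finite \<Rightarrow> (real^'n) set" and \<xi>\<^sub>0 :: "real^'n^'m"
  assumes D: "\<And>i. D i \<noteq> {}" "\<And>i. closed (D i)" "\<And>i. convex (D i)"
    and \<psi>: "\<psi> \<in> Theta" and \<theta>: "1/2 \<le> \<theta>" "\<theta> < 1"
    and kl: "KL_at (Psi \<psi> D) \<theta> x\<^sub>0" and fin: "frakM \<psi> D (x\<^sub>0, \<xi>\<^sub>0, u\<^sub>0) < \<infinity>"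
  shows "KL_at (frakM \<psi> D) \<theta> (x\<^sub>0, \<xi>\<^sub>0, u\<^sub>0)"
proof -
  obtain K where K: "K > 0" "\<And>s y. \<bar>rho_slope \<psi> s - rho_slope \<psi> y\<bar> \<le> K * \<bar>s - y\<bar>"
    using rho_slope_lipschitz[OF \<psi>] by blast
  define g where "g x = (\<Sum>i\<in>UNIV. \<psi> ((infdist x (D i))\<^sup>2))" for x
  have Psi: "Psi \<psi> D = (\<lambda>x. ereal (g x))" by (simp add: Psi_def g_def fun_eq_iff)
  have cont\<psi>: "continuous_on {0..} \<psi>" using \<psi> unfolding Theta_def by blast
  have "continuous_on UNIV (\<lambda>x. \<psi> ((infdist x (D i))\<^sup>2))" for i
    by (rule continuous_on_compose2[OF cont\<psi>]) (auto intro!: continuous_intros)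
  then have contg: "continuous_on UNIV g" unfolding g_def by (intro continuous_intros)
  obtain N C where N: "open N" "x\<^sub>0 \<in> N" and C: "C > 0"
    and klC: "\<And>x. x \<in> N \<Longrightarrow> g x\<^sub>0 < g x \<Longrightarrow> (g x - g x\<^sub>0) powr \<theta> \<le> C * norm (Psi_grad \<psi> D x)"
  proof (rule KL_atE_frechet[OF kl[unfolded Psi] \<theta>(2) contg])
    show "Psi_grad \<psi> D y \<in> frechet_subdiff (\<lambda>x. ereal (g x)) y" for y
      unfolding Psi[symmetric] by (rule Psi_grad_frechet[OF \<psi>]) (rule D)+
  qed blast
  obtain h\<^sub>0 where h\<^sub>0: "\<And>i. \<xi>\<^sub>0 $ i \<in> D i" "\<And>i. convex_conjugate (rho \<psi>) (u\<^sub>0 $ i) = ereal (h\<^sub>0 i)"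
    using frakM_finiteE[OF \<psi> fin] by blast
  define a where "a = real_of_ereal (frakM \<psi> D (x\<^sub>0, \<xi>\<^sub>0, u\<^sub>0))"
  have a: "frakM \<psi> D (x\<^sub>0, \<xi>\<^sub>0, u\<^sub>0) = ereal a" by (simp add: a_def frakM_eq[OF h\<^sub>0])
  \<comment> \<open>An excess of \<open>frakM\<close> over \<open>a\<close> is thus, up to the
    quadratic error, at most an excess of \<open>g\<close> over \<open>g x\<^sub>0\<close>.\<close>
  have ga: "g x\<^sub>0 \<le> a"
    using Psi_le_frakM[OF \<psi>, of D x\<^sub>0 \<xi>\<^sub>0 u\<^sub>0] by (simp add: a Psi)
  have u\<^sub>0: "u\<^sub>0 $ i < 0" for i by (rule conjugate_rho_finite_imp_neg[OF \<psi> h\<^sub>0(2)])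
  \<comment> \<open>Halving makes \<open>u\<^sub>0 $ i < - \<delta>\<close> strict, so it persists
    nearby; the \<open>+ 1\<close> in \<open>R\<close> below does the same for the
    distances.\<close>
  define \<delta> where "\<delta> = Min (range (\<lambda>i. - u\<^sub>0 $ i)) / 2"
  have "0 < Min (range (\<lambda>i. - u\<^sub>0 $ i))" using u\<^sub>0 by (subst Min_gr_iff) auto
  then have \<delta>: "\<delta> > 0" "2 * \<delta> \<le> - u\<^sub>0 $ i" for i by (auto simp: \<delta>_def)
  then have u\<delta>: "u\<^sub>0 $ i < - \<delta>" for i using \<delta>(2)[of i] \<delta>(1) by linarith
  define R where "R = Max (range (\<lambda>i. norm (x\<^sub>0 - \<xi>\<^sub>0 $ i))) + 1"
  have R: "norm (x\<^sub>0 - \<xi>\<^sub>0 $ i) < R" for i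
  proof -
    have "norm (x\<^sub>0 - \<xi>\<^sub>0 $ i) \<le> Max (range (\<lambda>i. norm (x\<^sub>0 - \<xi>\<^sub>0 $ i)))"
      by (intro Max_ge) auto
    then show ?thesis unfolding R_def by linarith
  qed
  define M :: "((real^'n) \<times> (real^'n^'m) \<times> (real^'m)) set" where
    "M = (fst -` N) \<inter> (\<Inter>i. {z. snd (snd z) $ i < - \<delta>}) \<inter> (\<Inter>i. {z. norm (fst z - fst (snd z) $ i) < R})"
  have "open M" unfolding M_def
    by (intro open_Int open_INT ballI open_vimage N continuous_intros open_Collect_less) auto
  moreover have "(x\<^sub>0, \<xi>\<^sub>0, u\<^sub>0) \<in> M" using N(2) u\<delta> R by (simp add: M_def)
  moreover define m where "m = real CARD('m)"
  define B where "B = m * (right_deriv \<psi> 0 / (2 * \<delta>\<^sup>2) + K)"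
  define G where "G = m * (2 * K * R * (1 + 1 / (2 * \<delta>\<^sup>2)) + right_deriv \<psi> 0 / \<delta>)"
  \<comment> \<open>The summand 1 makes \<open>C' \<ge> 1\<close>, which settles subgradients of
    norm above 1 because \<open>r < 1\<close>.\<close>
  define C' where "C' = 2 * (C * (1 + G) + B powr \<theta>) + 1"
  have l: "right_deriv \<psi> 0 > 0" by (rule Theta_right_deriv_pos[OF \<psi>]) simp
  have "R > 0" using R[of undefined] norm_ge_zero by (rule le_less_trans[rotated])
  then have BG: "B \<ge> 0" "G \<ge> 0" using l K(1) \<delta>(1) by (auto simp: B_def G_def m_def)
  then have "C' \<ge> 1" "C' > 0" using C by (auto simp: C'_def add_nonneg_pos)
  moreover have "r powr \<theta> \<le> C' * norm v"
    if z: "z \<in> M" "frakM \<psi> D z = ereal (a + r)" "0 < r" "r < 1" and v: "v \<in> frechet_subdiff (frakM \<psi> D) z"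
    for z r v
  proof (cases "norm v \<le> 1")
    case False
    have "r powr \<theta> \<le> 1 powr \<theta>" using z \<theta> by (intro powr_mono2) auto
    also have "\<dots> \<le> 1 * norm v" using False by simp
    also have "\<dots> \<le> C' * norm v" using \<open>C' \<ge> 1\<close> by (intro mult_right_mono) auto
    finally show ?thesis .
  next
    case True
    obtain x \<xi> u where zz: "z = (x, \<xi>, u)" by (metis prod_cases3)
    obtain vx v\<xi> vu where vv: "v = (vx, v\<xi>, vu)" by (metis prod_cases3)
    define n where "n = norm v"
    have n: "0 \<le> n" "n \<le> 1" using True by (simp_all add: n_def)
    have nx: "norm vx \<le> n" and n2: "norm (v\<xi>, vu) \<le> n"
      unfolding n_def vv by (rule norm_fst_le norm_snd_le)+
    have n\<xi>: "norm (v\<xi> $ i) \<le> n" for i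
      using Finite_Cartesian_Product.norm_nth_le[of v\<xi> i] norm_fst_le[of v\<xi> vu] n2 by linarith
    have nu: "\<bar>vu $ i\<bar> \<le> n" for i
      using component_le_norm_cart[of vu i] norm_snd_le[of vu v\<xi>] n2 by linarith
    obtain h where h: "\<And>i. \<xi> $ i \<in> D i" "\<And>i. convex_conjugate (rho \<psi>) (u $ i) = ereal (h i)"
      using frakM_finiteE[OF \<psi>, of D x \<xi> u] z(2) by (auto simp: zz)
    note fr = frakM_frechetD[OF \<psi> D(3) h v[unfolded zz vv]]
    have ui: "u $ i < - \<delta>" and xi: "norm (x - \<xi> $ i) \<le> R" and xN: "x \<in> N" for i
      using z(1) by (auto simp: M_def zz less_imp_le)
    note est = frakM_block_estimate[OF \<psi> K(2,1) D(2,3) h(1) \<delta>(1) ui xi n\<xi> nu n(2) fr(2,3,4)]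
    have "a + r = (\<Sum>i\<in>UNIV. h i - u $ i * (norm (x - \<xi> $ i))\<^sup>2)"
      using z(2) by (simp add: zz frakM_eq[OF h])
    also have "\<dots> \<le> (\<Sum>i\<in>UNIV. \<psi> ((infdist x (D i))\<^sup>2) + (right_deriv \<psi> 0 / (2 * \<delta>\<^sup>2) + K) * n\<^sup>2)"
      by (rule sum_mono) (rule est(1))
    also have "\<dots> = g x + B * n\<^sup>2" by (simp add: g_def sum.distrib B_def m_def)
    \<comment> \<open>The maximum with 0 covers \<open>g x \<le> g x\<^sub>0\<close>, where the KL
      inequality of \<Psi> gives nothing and the quadratic error alone bounds
      \<open>r\<close>.\<close>
    finally have rB: "r \<le> max 0 (g x - g x\<^sub>0) + B * n\<^sup>2" using ga by simp
    have "norm (Psi_grad \<psi> D x - vx) \<le> G * n"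
    proof -
      have "Psi_grad \<psi> D x - vx = (\<Sum>i\<in>UNIV. (2 * right_deriv \<psi> ((infdist x (D i))\<^sup>2)) *\<^sub>R (x - closest_point (D i) x)
          - (- 2 * u $ i) *\<^sub>R (x - \<xi> $ i))"
        unfolding Psi_grad_def fr(1) by (rule sum_subtractf[symmetric])
      also have "norm \<dots> \<le> (\<Sum>i\<in>(UNIV::'m set). (2 * K * R * (1 + 1 / (2 * \<delta>\<^sup>2)) + right_deriv \<psi> 0 / \<delta>) * n)"
        by (intro sum_norm_le est(2))
      also have "\<dots> = G * n" by (simp only: G_def m_def sum_constant mult.assoc)
      finally show ?thesis .
    qed
    then have "norm (Psi_grad \<psi> D x) \<le> (1 + G) * n"
      using norm_triangle_sub[of "Psi_grad \<psi> D x" vx] nx by (simp add: algebra_simps)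
    then have "C * norm (Psi_grad \<psi> D x) \<le> C * ((1 + G) * n)"
      using C by (intro mult_left_mono) auto
    moreover have "0 \<le> C * ((1 + G) * n)" using C BG n by simp
    ultimately have "max 0 (g x - g x\<^sub>0) powr \<theta> \<le> C * (1 + G) * n"
      using klC[OF xN] by (cases "g x\<^sub>0 < g x") (auto simp: max_def mult.assoc)
    then have "r powr \<theta> \<le> 2 * (C * (1 + G) + B powr \<theta>) * n"
      by (intro powr_add_quadratic_le[OF \<theta> z(3) rB]) (use n BG in auto)
    also have "\<dots> \<le> C' * n" using n by (intro mult_right_mono) (auto simp: C'_def)
    finally show ?thesis by (simp add: n_def)
  qed
  ultimately show ?thesis
    using \<theta> by (intro KL_atI_frechet[where f="frakM \<psi> D" and z="(x\<^sub>0, \<xi>\<^sub>0, u\<^sub>0)" and N=M and C=C' and a=a]) (auto simp: a)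
qed

theorem theorem5p7:
  fixes D :: "'m::finite \<Rightarrow> (real^'n) set"
    and \<psi> :: "real \<Rightarrow> real" and \<theta> :: real
  assumes "\<And>i. D i \<noteq> {}" and "\<And>i. closed (D i)" and "\<And>i. convex (D i)"
    and "\<psi> \<in> Theta" and "strictly_concave_on {0..} \<psi>"
    and "1/2 \<le> \<theta>" and "\<theta> < 1"
    and "KL_function (Psi \<psi> D) \<theta>"
  shows "KL_function (frakM \<psi> D) \<theta>"
  unfolding KL_function_def
proof (intro conjI ballI)
  fix z assume "z \<in> dom_subdiff (frakM \<psi> D)"
  then have fin: "frakM \<psi> D z < \<infinity>"
    by (auto simp: dom_subdiff_def limiting_subdiff_def dom_def)
  obtain x \<xi> u where z: "z = (x, \<xi>, u)" by (metis prod_cases3)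
  \<comment> \<open>\<Psi> has a Frechet subgradient everywhere, so its KL property is available at
    the \<open>x\<close> part of any \<open>z\<close>.\<close>
  have "x \<in> dom_subdiff (Psi \<psi> D)"
    using Psi_grad_frechet[OF assms(4,1,2,3)] frechet_subset_limiting by (fastforce simp: dom_subdiff_def)
  then have "KL_at (Psi \<psi> D) \<theta> x" using assms(8) by (simp add: KL_function_def)
  from frakM_KL_at[OF assms(1,2,3,4,6,7) this fin[unfolded z]]
  show "KL_at (frakM \<psi> D) \<theta> z" by (simp add: z)
qed (use assms frakM_proper[of \<psi> D] frakM_closed[of \<psi> D] in auto)

end
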